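(* Let $E$ be a polygonal element (of a mesh $\Omega_h$) satisfying the mesh assumptions (M1)-(M2). Then there exists a real, positive constant $C$ independent of $h$ such that for all virtual element functions $v_h\in V_h$ it holds that $$\|v_h-\widetilde\Pi^Ev_h\|_{0,E}\le C\,h_E\,|v_h|_{1,E}.$$
   Context: $\Omega\subset\mathbb R^2$ is an open, bounded, polygonal domain with Lipschitz boundary. $\Omega_h$ is a decomposition of $\Omega$ into nonoverlapping open polygons $E$ with straight edges $e$ whose closures cover $\overline\Omega$, the boundaries of two distinct elements intersecting in the empty set, in common vertices, or in shared edges. $|E|$ is the area of $E$, $h_E$ its diameter, $x_1,\dots,x_{N^E}$ its vertices, $h=\max_Eh_E$. For a fixed $\rho>0$ independent of $h$: (M1) every $E$ is star-shaped with respect to a ball of radius greater than $\rho h_E$; (M2) every edge of $E$ has length at least $\rho h_E$. $\mathbb P_1$ denotes polynomials of degree at most $1$. $V_h(E)=\{v_h\in H^1(E)\cap C(\overline E): v_h|_{\partial E}\in C(\partial E),\ v_h|_e\in\mathbb P_1(e)\ \forall e\subset\partial E,\ \Delta v_h=0\text{ in }E\}$; $V_h=\{v_h\in H^1_0(\Omega): v_h|_E\in V_h(E)\ \forall E\in\Omega_h\}$. With $[v_h,w_h]_E=|E|\sum_{i=1}^{N^E}v_h(x_i)w_h(x_i)$, $\widetilde\Pi^E:V_h(E)\to\mathbb P_1(E)$ is defined by $[v_h-\widetilde\Pi^Ev_h,q]_E=0$ for all $q\in\mathbb P_1(E)$; it is applied to $v_h|_E$. $\|\cdot\|_{0,E}$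 and $|\cdot|_{1,E}$ are the $L^2(E)$ norm and $H^1(E)$ seminorm. Constants $C$ may depend on the mesh regularity constant $\rho$. *)

theory Defs
  imports "HOL-Analysis.Analysis"
begin

section \<open>Sobolev spaces on subsets of the plane\<close>

text \<open>Functions are everywhere-defined representatives; only their values on the set under
  consideration matter.\<close>

definition pderivative :: "2 \<Rightarrow> (real^2 \<Rightarrow> real) \<Rightarrow> real^2 \<Rightarrow> real" where
  "pderivative i f x = frechet_derivative f (at x) (axis i 1)"

definition laplacian :: "(real^2 \<Rightarrow> real) \<Rightarrow> real^2 \<Rightarrow> real" where
  "laplacian f x = (\<Sum>i\<in>UNIV. pderivative i (pderivative i f) x)"

fun C_k :: "nat \<Rightarrow> (real^2 \<Rightarrow> real) \<Rightarrow> bool" where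
  "C_k 0 f \<longleftrightarrow> continuous_on UNIV f"
| "C_k (Suc k) f \<longleftrightarrow> (\<forall>x. f differentiable (at x)) \<and> (\<forall>i. C_k k (pderivative i f))"

definition test_functions :: "(real^2) set \<Rightarrow> (real^2 \<Rightarrow> real) set" where
  "test_functions S =
     {\<phi>. (\<forall>k. C_k k \<phi>) \<and> compact (closure {x. \<phi> x \<noteq> 0}) \<and> closure {x. \<phi> x \<noteq> 0} \<subseteq> S}"

definition L2 :: "(real^2) set \<Rightarrow> (real^2 \<Rightarrow> 'b::euclidean_space) \<Rightarrow> bool" where
  "L2 S f \<longleftrightarrow> set_borel_measurable lebesgue S f \<and> set_integrable lebesgue S (\<lambda>x. (norm (f x))\<^sup>2)"

definition L2_norm :: "(real^2) set \<Rightarrow> (real^2 \<Rightarrow> 'b::euclidean_space) \<Rightarrow> real" where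
  "L2_norm S f = sqrt (LINT x:S|lebesgue. (norm (f x))\<^sup>2)"

definition L2_weak_gradient ::
    "(real^2) set \<Rightarrow> (real^2 \<Rightarrow> real) \<Rightarrow> (real^2 \<Rightarrow> real^2) \<Rightarrow> bool" where
  "L2_weak_gradient S u g \<longleftrightarrow> L2 S g \<and>
     (\<forall>\<phi>\<in>test_functions S. \<forall>i.
        (LINT x:S|lebesgue. u x * pderivative i \<phi> x) = - (LINT x:S|lebesgue. g x $ i * \<phi> x))"

definition H1 :: "(real^2) set \<Rightarrow> (real^2 \<Rightarrow> real) set" where
  "H1 S = {u. L2 S u \<and> (\<exists>g. L2_weak_gradient S u g)}"

text \<open>On open \<open>S\<close> the weak gradient is unique up to a null set, so the choice below is immaterial
  for \<open>u \<in> H1 S\<close>.\<close>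

definition weak_gradient :: "(real^2) set \<Rightarrow> (real^2 \<Rightarrow> real) \<Rightarrow> real^2 \<Rightarrow> real^2" where
  "weak_gradient S u = (SOME g. L2_weak_gradient S u g)"

definition H1_seminorm :: "(real^2) set \<Rightarrow> (real^2 \<Rightarrow> real) \<Rightarrow> real" where
  "H1_seminorm S u = L2_norm S (weak_gradient S u)"

definition H1_norm :: "(real^2) set \<Rightarrow> (real^2 \<Rightarrow> real) \<Rightarrow> real" where
  "H1_norm S u = sqrt ((L2_norm S u)\<^sup>2 + (H1_seminorm S u)\<^sup>2)"

text \<open>\<open>H\<^sup>1\<^sub>0\<close> is the closure of the test functions in the \<open>H\<^sup>1\<close> norm.\<close>

definition H1_0 :: "(real^2) set \<Rightarrow> (real^2 \<Rightarrow> real) set" where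
  "H1_0 S = {u \<in> H1 S. \<forall>\<epsilon>>0. \<exists>\<phi>\<in>test_functions S. H1_norm S (\<lambda>x. u x - \<phi> x) < \<epsilon>}"

text \<open>\<open>\<Delta>u = 0\<close> in \<open>S\<close>, in the sense of distributions.\<close>

definition harmonic_in :: "(real^2) set \<Rightarrow> (real^2 \<Rightarrow> real) \<Rightarrow> bool" where
  "harmonic_in S u \<longleftrightarrow>
     (\<forall>\<phi>\<in>test_functions S. (LINT x:S|lebesgue. u x * laplacian \<phi> x) = 0)"

text \<open>Real polynomials of degree at most one in two variables.\<close>

definition P1 :: "(real^2 \<Rightarrow> real) set" where
  "P1 = {p. \<exists>a b. p = (\<lambda>x. a + b \<bullet> x)}"


section \<open>Polygons and meshes\<close>

text \<open>A polygon is given by the cyclic list of its vertices. Consecutive edges may be collinear,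
  so that hanging nodes of a mesh count as vertices.\<close>

type_synonym polygon = "(real^2) list"

definition vertex :: "polygon \<Rightarrow> nat \<Rightarrow> real^2" where
  "vertex P i = P ! (i mod length P)"

definition edge :: "polygon \<Rightarrow> nat \<Rightarrow> (real^2) set" where
  "edge P i = closed_segment (vertex P i) (vertex P (Suc i))"

definition edges :: "polygon \<Rightarrow> (real^2) set set" where
  "edges P = edge P ` {..<length P}"

definition simple_polygon :: "polygon \<Rightarrow> bool" where
  "simple_polygon P \<longleftrightarrow> length P \<ge> 3 \<and> distinct P \<and>
     (\<forall>i<length P. \<forall>j<length P. i \<noteq> j \<longrightarrow>
        edge P i \<inter> edge P j = {vertex P i, vertex P (Suc i)} \<inter> {vertex P j, vertex P (Suc j)})"

text \<open>The open polygon: the bounded component of the complement of the Jordan curve formed by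
  the edges.\<close>

definition region :: "polygon \<Rightarrow> (real^2) set" where
  "region P = inside (\<Union>(edges P))"

text \<open>Locally, after a rigid motion, the set is the strict epigraph of a Lipschitz function.\<close>

definition lipschitz_boundary :: "(real^2) set \<Rightarrow> bool" where
  "lipschitz_boundary S \<longleftrightarrow>
     (\<forall>x\<in>frontier S. \<exists>U e n \<gamma> L. open U \<and> x \<in> U \<and>
        norm e = 1 \<and> norm n = 1 \<and> e \<bullet> n = 0 \<and> L-lipschitz_on UNIV (\<gamma> :: real \<Rightarrow> real) \<and>
        S \<inter> U = {y \<in> U. \<gamma> (y \<bullet> e) < y \<bullet> n})"

definition polygonal_domain :: "(real^2) set \<Rightarrow> bool" where
  "polygonal_domain \<Omega> \<longleftrightarrow> open \<Omega> \<and> connected \<Omega> \<and> bounded \<Omega> \<and> \<Omega> \<noteq> {} \<and>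
     (\<exists>A. finite A \<and> frontier \<Omega> = (\<Union>(a, b)\<in>A. closed_segment a b)) \<and>
     lipschitz_boundary \<Omega>"

definition polygonal_mesh :: "(real^2) set \<Rightarrow> polygon set \<Rightarrow> bool" where
  "polygonal_mesh \<Omega> \<T> \<longleftrightarrow> finite \<T> \<and>
     (\<forall>E\<in>\<T>. simple_polygon E \<and> region E \<subseteq> \<Omega>) \<and>
     (\<Union>E\<in>\<T>. closure (region E)) = closure \<Omega> \<and>
     (\<forall>E\<in>\<T>. \<forall>F\<in>\<T>. E \<noteq> F \<longrightarrow>
        region E \<inter> region F = {} \<and>
        frontier (region E) \<inter> frontier (region F) =
          (set E \<inter> set F) \<union> \<Union>(edges E \<inter> edges F))"

definition mesh_M1 :: "real \<Rightarrow> polygon set \<Rightarrow> bool" where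
  "mesh_M1 \<rho> \<T> \<longleftrightarrow> (\<forall>E\<in>\<T>. \<exists>c r. r > \<rho> * diameter (region E) \<and> ball c r \<subseteq> region E \<and>
     (\<forall>y\<in>ball c r. \<forall>x\<in>region E. closed_segment y x \<subseteq> region E))"

definition mesh_M2 :: "real \<Rightarrow> polygon set \<Rightarrow> bool" where
  "mesh_M2 \<rho> \<T> \<longleftrightarrow> (\<forall>E\<in>\<T>. \<forall>i<length E.
     dist (vertex E i) (vertex E (Suc i)) \<ge> \<rho> * diameter (region E))"


section \<open>The virtual element space\<close>

definition Vh_local :: "polygon \<Rightarrow> (real^2 \<Rightarrow> real) set" where
  "Vh_local E = {v. v \<in> H1 (region E) \<and> continuous_on (closure (region E)) v \<and>
     continuous_on (frontier (region E)) v \<and>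
     (\<forall>e\<in>edges E. \<exists>p\<in>P1. \<forall>x\<in>e. v x = p x) \<and>
     harmonic_in (region E) v}"

text \<open>A function in \<open>Vh\<close> is represented by its representative that is continuous on the closure
  of every element.\<close>

definition Vh :: "(real^2) set \<Rightarrow> polygon set \<Rightarrow> (real^2 \<Rightarrow> real) set" where
  "Vh \<Omega> \<T> = {v \<in> H1_0 \<Omega>. \<forall>E\<in>\<T>. v \<in> Vh_local E}"

definition vertex_product :: "polygon \<Rightarrow> (real^2 \<Rightarrow> real) \<Rightarrow> (real^2 \<Rightarrow> real) \<Rightarrow> real" where
  "vertex_product E v w =
     measure lebesgue (region E) * (\<Sum>i<length E. v (vertex E i) * w (vertex E i))"

text \<open>For a simple polygon the vertices are not collinear, so the defining condition has exactly
  one solution.\<close>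

definition vertex_projection :: "polygon \<Rightarrow> (real^2 \<Rightarrow> real) \<Rightarrow> real^2 \<Rightarrow> real" where
  "vertex_projection E v =
     (THE p. p \<in> P1 \<and> (\<forall>q\<in>P1. vertex_product E (\<lambda>x. v x - p x) q = 0))"

end

theory Submission
  imports Defs
begin

text \<open>
  Write \<open>E\<close> for the element, \<open>h\<close> for its diameter, \<open>B\<close> for the ball with respect to which it is
  star-shaped, and \<open>p\<close> for the projection of \<open>v\<close>. The projection is the least squares fit of \<open>v\<close> at
  the vertices, and it reproduces constants. Hence, for every constant \<open>k\<close>, the sum of
  \<open>(p - k)\<^sup>2\<close> over the vertices is at most the sum of \<open>(v - k)\<^sup>2\<close> over the vertices. As \<open>E\<close> lies in
  the convex hull of its vertices and \<open>p\<close> is affine, this also bounds \<open>(p - k)\<^sup>2\<close> on all of \<open>E\<close>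
  (lemma \<open>vertex_projection_stable\<close>). Moreover \<open>v - k\<close> is affine on every edge, so its square at a
  vertex is at most four times its mean square on an edge (\<open>affine_endpoint_le\<close>). What remains is
  to find one number \<open>k\<close> such that \<open>v - k\<close> is small in mean square both on \<open>E\<close> and on every edge;
  this is \<open>good_reference_value\<close>.

  Such a \<open>k\<close> is found among the values \<open>v y\<close> with \<open>y\<close> in \<open>B\<close>, by averaging over \<open>y\<close>. Let \<open>\<mu>\<close> be
  arc length on an edge or area on \<open>E\<close>. The difference \<open>v x - v y\<close> is an integral of the
  gradient along the segment from \<open>x\<close> to \<open>y\<close>, which lies in \<open>E\<close>. If this is squared and integrated
  over \<open>y\<close> and over \<open>x\<close>, a substitution turns the points \<open>x + t (y - x)\<close> into area measure, and
  it suffices that balls of radius \<open>R\<close> have \<open>\<mu>\<close>-measure at most a multiple of \<open>R\<close>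
  (\<open>potential_estimate\<close>). A function that only has a weak gradient is first contracted towards
  the centre of \<open>B\<close> and then mollified: the contraction keeps the mollification kernels inside \<open>E\<close>,
  where they are admissible test functions, and mollification does not increase the \<open>L\<^sup>2\<close> norm of the
  gradient (\<open>smooth_approximation\<close>, \<open>averaged_difference_estimate\<close>).

  The constant depends on \<open>\<rho>\<close> alone because \<open>\<rho>\<close> bounds the number of edges. The triangles spanned by the
  centre of \<open>B\<close> and an edge overlap only in null sets, since every ray from the centre meets the
  boundary once; each has area at least \<open>\<rho>\<^sup>2 h\<^sup>2 / 2\<close>, since the line through an edge misses \<open>B\<close>; and
  they all lie in a disc of radius \<open>h\<close> (\<open>number_of_edges\<close>). This uses that every edge belongs to the
  frontier of the region, which is a consequence of the Jordan curve theorem.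
\<close>

section \<open>Smooth bump functions\<close>

text \<open>The profiles \<open>t\<^sup>-\<^sup>k exp (-1/t)\<close>, extended by zero to \<open>t \<le> 0\<close>. The whole family is needed
  because differentiation leads from index \<open>k\<close> to the indices \<open>k + 1\<close> and \<open>k + 2\<close>.\<close>

definition bump_profile :: "nat \<Rightarrow> real \<Rightarrow> real" where
  "bump_profile k t = (if t > 0 then (1 / t) ^ k * exp (- (1 / t)) else 0)"

lemma bump_profile_nonneg: "bump_profile k t \<ge> 0"
  by (simp add: bump_profile_def)

lemma bump_profile_0_pos_iff: "bump_profile 0 t > 0 \<longleftrightarrow> t > 0"
  by (simp add: bump_profile_def)

text \<open>With \<open>u = 1/t\<close> this is the fact that \<open>exp u\<close> outgrows \<open>u\<^sup>k\<close>. Applied to the index \<open>k + 1\<close> it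
  shows that the difference quotients of the profile \<open>k\<close> at the origin tend to zero.\<close>

lemma bump_profile_tendsto_0: "(bump_profile k \<longlongrightarrow> 0) (at 0)"
proof -
  have "((\<lambda>t::real. (1 / t) ^ k * exp (- (1 / t))) \<longlongrightarrow> 0) (at_right 0)"
    using filterlim_compose[OF tendsto_power_div_exp_0[of k] filterlim_inverse_at_top_right]
    by (simp add: exp_minus field_simps)
  then have "(bump_profile k \<longlongrightarrow> 0) (at_right 0)"
    by (rule Lim_transform_eventually)
       (auto simp: bump_profile_def eventually_at_right_field intro!: exI[of _ 1])
  moreover have "(bump_profile k \<longlongrightarrow> 0) (at_left 0)"
    by (rule Lim_transform_eventually[OF tendsto_const])
       (auto simp: bump_profile_def eventually_at_left_field intro!: exI[of _ "-1"])
  ultimately show ?thesis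
    by (simp add: filterlim_split_at)
qed

lemma bump_profile_has_derivative:
  "(bump_profile k has_field_derivative (bump_profile (k + 2) t - k * bump_profile (k + 1) t)) (at t)"
proof -
  consider "t > 0" | "t < 0" | "t = 0" by linarith
  then show ?thesis
  proof cases
    case 1
    have "((\<lambda>t. (1 / t) ^ k * exp (- (1 / t))) has_field_derivative
        (bump_profile (k + 2) t - k * bump_profile (k + 1) t)) (at t)"
      using 1 by (cases k)
        (auto intro!: derivative_eq_intros simp: bump_profile_def field_simps power2_eq_square,
         metis One_nat_def Suc_pred gr0I power_Suc)
    then show ?thesis
      by (rule DERIV_cong_ev[THEN iffD2, rotated -1, OF _ refl _ refl])
         (use 1 in \<open>auto simp: bump_profile_def intro!: eventually_nhds_in_open[of "{0<..}", THEN eventually_mono]\<close>)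
  next
    case 2
    have "((\<lambda>t. 0) has_field_derivative (bump_profile (k + 2) t - k * bump_profile (k + 1) t)) (at t)"
      using 2 by (simp add: bump_profile_def)
    then show ?thesis
      by (rule DERIV_cong_ev[THEN iffD2, rotated -1, OF _ refl _ refl])
         (use 2 in \<open>auto simp: bump_profile_def intro!: eventually_nhds_in_open[of "{..<0}", THEN eventually_mono]\<close>)
  next
    case 3
    have "((\<lambda>t. bump_profile k t / t) \<longlongrightarrow> 0) (at 0)"
      by (rule Lim_transform_eventually[OF bump_profile_tendsto_0[of "Suc k"]])
         (auto simp: bump_profile_def eventually_at_filter)
    then show ?thesis
      using 3 by (simp add: has_field_derivative_iff bump_profile_def)
  qed
qed

text \<open>A class of functions that contains the mollification kernels and is closed under partial
  derivatives; closure under derivatives gives derivatives of every order at once.\<close>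

inductive elementary_smooth :: "(real^2 \<Rightarrow> real) \<Rightarrow> bool" where
  const: "elementary_smooth (\<lambda>x. a)"
| coord: "elementary_smooth (\<lambda>x. x $ i)"
| add: "elementary_smooth f \<Longrightarrow> elementary_smooth g \<Longrightarrow> elementary_smooth (\<lambda>x. f x + g x)"
| mult: "elementary_smooth f \<Longrightarrow> elementary_smooth g \<Longrightarrow> elementary_smooth (\<lambda>x. f x * g x)"
| profile: "elementary_smooth f \<Longrightarrow> elementary_smooth (\<lambda>x. bump_profile k (f x))"

lemma elementary_smooth_derivative:
  assumes "elementary_smooth f"
  shows "\<exists>D. (\<forall>x. (f has_derivative D x) (at x)) \<and> (\<forall>d. elementary_smooth (\<lambda>x. D x d))"
  using assms
proof induction
  case (const a)
  then show ?case
    by (intro exI[of _ "\<lambda>x d. 0"]) (auto intro: elementary_smooth.const)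
next
  case (coord i)
  then show ?case
    by (intro exI[of _ "\<lambda>x d. d $ i"])
       (auto intro: elementary_smooth.const bounded_linear_imp_has_derivative bounded_linear_vec_nth)
next
  case (add f g)
  then obtain D D' where
    "\<forall>x. (f has_derivative D x) (at x)" "\<forall>d. elementary_smooth (\<lambda>x. D x d)"
    "\<forall>x. (g has_derivative D' x) (at x)" "\<forall>d. elementary_smooth (\<lambda>x. D' x d)"
    by blast
  then show ?case
    by (intro exI[of _ "\<lambda>x d. D x d + D' x d"])
       (auto intro: elementary_smooth.add has_derivative_add)
next
  case (mult f g)
  then obtain D D' where
    "\<forall>x. (f has_derivative D x) (at x)" "\<forall>d. elementary_smooth (\<lambda>x. D x d)"
    "\<forall>x. (g has_derivative D' x) (at x)" "\<forall>d. elementary_smooth (\<lambda>x. D' x d)"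
    by blast
  then show ?case
    using mult.hyps
    by (intro exI[of _ "\<lambda>x d. f x * D' x d + D x d * g x"])
       (auto intro!: elementary_smooth.add elementary_smooth.mult has_derivative_mult)
next
  case (profile f k)
  then obtain D where D:
    "\<And>x. (f has_derivative D x) (at x)" "\<forall>d. elementary_smooth (\<lambda>x. D x d)"
    by blast
  let ?F = "\<lambda>x. bump_profile (k + 2) (f x) + (- real k) * bump_profile (k + 1) (f x)"
  have "((\<lambda>x. bump_profile k (f x)) has_derivative (\<lambda>d. ?F x * D x d)) (at x)" for x
    using DERIV_compose_FDERIV[OF bump_profile_has_derivative D(1), of k x] 
    by (simp add: mult.commute)
  moreover have "elementary_smooth (\<lambda>x. ?F x * D x d)" for d
    using D(2) profile.hyps by (intro elementary_smooth.intros) auto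
  ultimately show ?case
    by (intro exI[of _ "\<lambda>x d. ?F x * D x d"]) auto
qed

lemma elementary_smooth_C_k: "elementary_smooth f \<Longrightarrow> C_k k f"
proof (induction k arbitrary: f)
  case 0
  then show ?case
    using elementary_smooth_derivative[OF 0]
    by (auto simp: continuous_on_eq_continuous_at intro: has_derivative_continuous)
next
  case (Suc k)
  obtain D where D: "\<And>x. (f has_derivative D x) (at x)" "\<And>d. elementary_smooth (\<lambda>x. D x d)"
    using elementary_smooth_derivative[OF Suc.prems] by blast
  have "pderivative i f = (\<lambda>x. D x (axis i 1))" for i
    using frechet_derivative_at[OF D(1)] by (auto simp: pderivative_def fun_eq_iff) 
  with D Suc.IH show ?case
    by (auto simp: differentiable_def)
qed

text \<open>A radial kernel that is positive exactly on the ball of radius \<open>\<epsilon>\<close>. It is left unnormalised; its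
  mass is divided out in the mollification.\<close>

definition bump :: "real \<Rightarrow> real^2 \<Rightarrow> real" where
  "bump \<epsilon> x = bump_profile 0 (\<epsilon>\<^sup>2 - x \<bullet> x)"

definition bump_grad :: "real \<Rightarrow> real^2 \<Rightarrow> real^2" where
  "bump_grad \<epsilon> x = (- 2 * bump_profile 2 (\<epsilon>\<^sup>2 - x \<bullet> x)) *\<^sub>R x"

lemma bump_nonneg: "bump \<epsilon> x \<ge> 0"
  by (simp add: bump_def bump_profile_nonneg)

lemma bump_pos_iff:
  assumes "\<epsilon> > 0" shows "bump \<epsilon> x > 0 \<longleftrightarrow> norm x < \<epsilon>"
  using assms abs_square_less_1 power_strict_mono[of "norm x" \<epsilon> 2] power2_less_imp_less[of "norm x" \<epsilon>]
  by (auto simp: bump_def bump_profile_0_pos_iff simp flip: power2_norm_eq_inner)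

lemma bump_eq_0:
  assumes "\<epsilon> > 0" "norm x \<ge> \<epsilon>" shows "bump \<epsilon> x = 0"
  using bump_pos_iff[OF assms(1), of x] bump_nonneg[of \<epsilon> x] assms(2) by linarith

lemma bump_has_derivative: "(bump \<epsilon> has_derivative (\<lambda>d. bump_grad \<epsilon> x \<bullet> d)) (at x)"
proof -
  have "((\<lambda>x. \<epsilon>\<^sup>2 - x \<bullet> x) has_derivative (\<lambda>d. - (2 * (x \<bullet> d)))) (at x)"
    by (auto intro!: derivative_eq_intros simp: inner_commute)
  from DERIV_compose_FDERIV[OF bump_profile_has_derivative this, of 0] show ?thesis
    by (simp add: bump_def[abs_def] bump_grad_def algebra_simps numeral_2_eq_2)
qed

lemma continuous_on_bump_profile [continuous_intros]:
  "continuous_on S f \<Longrightarrow> continuous_on S (\<lambda>x. bump_profile k (f x))"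
  using bump_profile_has_derivative
  by (intro continuous_on_compose2[of UNIV "bump_profile k" S f])
     (auto simp: continuous_on_eq_continuous_at intro!: DERIV_isCont)

lemma continuous_on_bump [continuous_intros]:
  "continuous_on S f \<Longrightarrow> continuous_on S (\<lambda>x. bump \<epsilon> (f x))"
  unfolding bump_def by (intro continuous_intros)

lemma continuous_on_bump_grad [continuous_intros]:
  "continuous_on S f \<Longrightarrow> continuous_on S (\<lambda>x. bump_grad \<epsilon> (f x))"
  unfolding bump_grad_def by (intro continuous_intros)

lemma bump_grad_eq_0:
  assumes "\<epsilon> > 0" "norm x \<ge> \<epsilon>" shows "bump_grad \<epsilon> x = 0"
proof -
  have "\<not> (norm x)\<^sup>2 < \<epsilon>\<^sup>2" using assms power_mono[of \<epsilon> "norm x" 2] by linarith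
  then show ?thesis by (simp add: bump_grad_def bump_profile_def flip: power2_norm_eq_inner)
qed

lemma pderivative_bump_translate:
  "pderivative i (\<lambda>y. bump \<epsilon> (p - y)) y = - bump_grad \<epsilon> (p - y) $ i"
proof -
  have "((\<lambda>y. bump \<epsilon> (p - y)) has_derivative (\<lambda>d. bump_grad \<epsilon> (p - y) \<bullet> (- d))) (at y)"
    by (rule has_derivative_compose[OF _ bump_has_derivative])
       (auto intro!: derivative_eq_intros)
  from frechet_derivative_at[OF this, symmetric] show ?thesis
    by (simp add: pderivative_def inner_axis)
qed

lemma bump_translate_test_function:
  assumes "\<epsilon> > 0" "cball p \<epsilon> \<subseteq> S"
  shows "(\<lambda>y. bump \<epsilon> (p - y)) \<in> test_functions S"
proof -
  have "{y. bump \<epsilon> (p - y) \<noteq> 0} \<subseteq> cball p \<epsilon>"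
    using bump_eq_0[OF assms(1)] by (force simp: dist_norm not_le)
  then have sub: "closure {y. bump \<epsilon> (p - y) \<noteq> 0} \<subseteq> cball p \<epsilon>"
    by (simp add: closure_minimal)
  have "elementary_smooth (\<lambda>y. bump_profile 0
      (\<epsilon>\<^sup>2 + (-1) * ((p $ 1 + (-1) * y $ 1) * (p $ 1 + (-1) * y $ 1) +
         (p $ 2 + (-1) * y $ 2) * (p $ 2 + (-1) * y $ 2))))"
    by (intro elementary_smooth.intros)
  then have "elementary_smooth (\<lambda>y. bump \<epsilon> (p - y))"
    by (simp add: bump_def inner_vec_def sum_2 algebra_simps)
  then have "\<forall>k. C_k k (\<lambda>y. bump \<epsilon> (p - y))"
    using elementary_smooth_C_k by blast
  moreover have "compact (closure {y. bump \<epsilon> (p - y) \<noteq> 0})"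
    using sub by (meson bounded_cball bounded_subset compact_eq_bounded_closed closed_closure)
  ultimately show ?thesis
    using sub assms(2) by (auto simp: test_functions_def)
qed

section \<open>An integral estimate for differentiable functions on star-shaped sets\<close>

lemma nn_integral_affine:
  fixes F :: "'a::euclidean_space \<Rightarrow> ennreal"
  assumes [measurable]: "F \<in> borel_measurable borel" and "t > 0"
  shows "(\<integral>\<^sup>+y. F (a + t *\<^sub>R y) \<partial>lborel) = ennreal (1 / t ^ DIM('a)) * (\<integral>\<^sup>+z. F z \<partial>lborel)"
proof -
  have "(\<integral>\<^sup>+z. F z \<partial>lborel) = ennreal (t ^ DIM('a)) * (\<integral>\<^sup>+y. F (a + t *\<^sub>R y) \<partial>lborel)"
    using \<open>t > 0\<close>
    by (subst lborel_affine[of t a])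
       (simp_all add: nn_integral_density nn_integral_distr nn_integral_cmult)
  then show ?thesis
    using \<open>t > 0\<close> by (simp add: mult.assoc[symmetric] ennreal_mult[symmetric])
qed

lemma square_integral_le:
  fixes f :: "real \<Rightarrow> real"
  assumes "continuous_on {0..1} f"
  shows "(integral {0..1} f)\<^sup>2 \<le> integral {0..1} (\<lambda>s. (f s)\<^sup>2)"
proof -
  let ?I = "integral {0..1} f"
  have [simp]: "f integrable_on {0..1}" "(\<lambda>s. (f s)\<^sup>2) integrable_on {0..1}"
    by (intro integrable_continuous_real continuous_intros assms)+
  have "0 \<le> integral {0..1} (\<lambda>s. (f s - ?I)\<^sup>2)"
    by (intro integral_nonneg integrable_continuous_real continuous_intros assms) auto
  also have "(\<lambda>s. (f s - ?I)\<^sup>2) = (\<lambda>s. ((f s)\<^sup>2 - (2 * ?I) * f s) + ?I\<^sup>2)"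
    by (auto simp: power2_eq_square algebra_simps)
  also have "integral {0..1} \<dots> = integral {0..1} (\<lambda>s. (f s)\<^sup>2) - (2 * ?I) * ?I + ?I\<^sup>2"
  proof (rule integral_unique)
    show "((\<lambda>s. ((f s)\<^sup>2 - (2 * ?I) * f s) + ?I\<^sup>2) has_integral
        (integral {0..1} (\<lambda>s. (f s)\<^sup>2) - (2 * ?I) * ?I + ?I\<^sup>2)) {0..1}"
      using has_integral_const_real[of "?I\<^sup>2" 0 1]
      by (intro has_integral_add has_integral_diff has_integral_mult_right integrable_integral) simp_all
  qed
  finally show ?thesis by (simp add: power2_eq_square)
qed

text \<open>The segment from \<open>x\<close> to \<open>y\<close> is run through as \<open>s \<mapsto> x + s\<^sup>2 (y - x)\<close>. The speed \<open>2 s\<close>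
  vanishes at \<open>x\<close>, and so the plain Cauchy-Schwarz inequality already produces the weight \<open>s\<^sup>2\<close>
  that later compensates the concentration of the points on the path near \<open>x\<close>.\<close>

lemma square_difference_le_path_integral:
  fixes w :: "real^2 \<Rightarrow> real" and \<gamma> :: "real^2 \<Rightarrow> real^2"
  assumes deriv: "\<And>p d s. ((\<lambda>s. w (p + s *\<^sub>R d)) has_field_derivative (\<gamma> (p + s *\<^sub>R d) \<bullet> d)) (at s)"
    and cont: "continuous_on UNIV \<gamma>"
  shows "ennreal ((w x - w y)\<^sup>2) \<le> (\<integral>\<^sup>+s. indicator {0..1} s *
     ennreal (4 * s\<^sup>2 * (norm (y - x))\<^sup>2 * (norm (\<gamma> (x + s\<^sup>2 *\<^sub>R (y - x))))\<^sup>2) \<partial>lborel)"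
proof -
  let ?d = "y - x"
  define f where "f s = 2 * s * (\<gamma> (x + s\<^sup>2 *\<^sub>R ?d) \<bullet> ?d)" for s :: real
  have cont': "continuous_on S (\<lambda>s. \<gamma> (q s))" if "continuous_on S q" for S :: "real set" and q
    using continuous_on_compose2[OF cont that] by simp
  have cf: "continuous_on {0..1} f"
    unfolding f_def by (intro continuous_intros cont')
  have "(f has_integral (w (x + 1\<^sup>2 *\<^sub>R ?d) - w (x + 0\<^sup>2 *\<^sub>R ?d))) {0..1}"
  proof (rule fundamental_theorem_of_calculus)
    fix s :: real
    have "((\<lambda>s. w (x + s\<^sup>2 *\<^sub>R ?d)) has_field_derivative (\<gamma> (x + s\<^sup>2 *\<^sub>R ?d) \<bullet> ?d) * (2 * s)) (at s)"
      by (rule DERIV_chain2[OF deriv]) (auto intro!: derivative_eq_intros)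
    then show "((\<lambda>s. w (x + s\<^sup>2 *\<^sub>R ?d)) has_vector_derivative f s) (at s within {0..1})"
      by (simp add: f_def has_real_derivative_iff_has_vector_derivative mult.commute mult.left_commute
          has_vector_derivative_at_within)
  qed simp
  then have "w x - w y = - integral {0..1} f" by (simp add: integral_unique)
  then have "(w x - w y)\<^sup>2 \<le> integral {0..1} (\<lambda>s. (f s)\<^sup>2)"
    using square_integral_le[OF cf] by simp
  then have "ennreal ((w x - w y)\<^sup>2) \<le> ennreal (integral {0..1} (\<lambda>s. (f s)\<^sup>2))"
    by (rule ennreal_leI)
  also have "\<dots> = (\<integral>\<^sup>+s. ennreal (indicator {0..1} s * (f s)\<^sup>2) \<partial>lborel)"
    by (rule nn_integral_has_integral_lebesgue[symmetric])
       (auto intro!: integrable_integral integrable_continuous_real continuous_intros cf)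
  also have "\<dots> \<le> (\<integral>\<^sup>+s. indicator {0..1} s *
     ennreal (4 * s\<^sup>2 * (norm (y - x))\<^sup>2 * (norm (\<gamma> (x + s\<^sup>2 *\<^sub>R (y - x))))\<^sup>2) \<partial>lborel)"
  proof (rule nn_integral_mono)
    fix s :: real
    have "(\<gamma> (x + s\<^sup>2 *\<^sub>R ?d) \<bullet> ?d)\<^sup>2 \<le> (norm (\<gamma> (x + s\<^sup>2 *\<^sub>R ?d)))\<^sup>2 * (norm ?d)\<^sup>2"
      using Cauchy_Schwarz_ineq by (simp add: power2_norm_eq_inner)
    then have "4 * s\<^sup>2 * (\<gamma> (x + s\<^sup>2 *\<^sub>R ?d) \<bullet> ?d)\<^sup>2 \<le> 4 * s\<^sup>2 * ((norm (\<gamma> (x + s\<^sup>2 *\<^sub>R ?d)))\<^sup>2 * (norm ?d)\<^sup>2)"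
      by (rule mult_left_mono) simp
    then show "ennreal (indicator {0..1} s * (f s)\<^sup>2) \<le> indicator {0..1} s *
       ennreal (4 * s\<^sup>2 * (norm (y - x))\<^sup>2 * (norm (\<gamma> (x + s\<^sup>2 *\<^sub>R (y - x))))\<^sup>2)"
      by (auto simp: indicator_def f_def power_mult_distrib mult_ac intro!: ennreal_leI)
  qed
  finally show ?thesis .
qed

text \<open>For fixed \<open>t\<close>, substitute \<open>z = x + t (y - x)\<close> for \<open>y\<close>, at the price of \<open>1 / t\<^sup>2\<close>, and exchange
  the integrals. For given \<open>z\<close>, the points \<open>x\<close> that occur with some \<open>y\<close> in \<open>B\<close> form a subset of a
  ball of radius \<open>t r / (1 - t)\<close>. So the growth of \<open>\<mu>\<close> gives back one factor \<open>t\<close>.\<close>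

lemma nn_integral_contraction_le:
  fixes \<mu> :: "(real^2) measure" and F :: "real^2 \<Rightarrow> ennreal"
  assumes sets [measurable_cong]: "sets \<mu> = sets borel" and sf: "sigma_finite_measure \<mu>"
    and growth: "\<And>p R. R > 0 \<Longrightarrow> emeasure \<mu> (cball p R) \<le> ennreal (A * R)"
    and total: "emeasure \<mu> UNIV \<le> ennreal (A * h)"
    and A: "A \<ge> 0" and r: "0 < r" "r \<le> h"
    and B [measurable]: "B \<in> sets borel" and B_sub: "B \<subseteq> cball c r"
    and F [measurable]: "F \<in> borel_measurable borel"
    and t: "0 < t" "t < 1"
  shows "(\<integral>\<^sup>+x. \<integral>\<^sup>+y. indicator B y * F (x + t *\<^sub>R (y - x)) \<partial>lborel \<partial>\<mu>)
           \<le> ennreal (2 * A * h / t) * (\<integral>\<^sup>+z. F z \<partial>lborel)"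
proof -
  interpret sigma_finite_measure \<mu> by fact
  interpret pair_sigma_finite \<mu> lborel ..
  let ?K = "\<lambda>x z. indicator B ((1 / t) *\<^sub>R (z - (1 - t) *\<^sub>R x)) :: ennreal"
  have "(\<integral>\<^sup>+x. \<integral>\<^sup>+y. indicator B y * F (x + t *\<^sub>R (y - x)) \<partial>lborel \<partial>\<mu>)
      = (\<integral>\<^sup>+x. ennreal (1 / t\<^sup>2) * (\<integral>\<^sup>+z. ?K x z * F z \<partial>lborel) \<partial>\<mu>)"
  proof (rule nn_integral_cong)
    fix x
    have [measurable]: "?K x \<in> borel_measurable borel" by measurable
    have "(\<integral>\<^sup>+y. indicator B y * F (x + t *\<^sub>R (y - x)) \<partial>lborel)
        = (\<integral>\<^sup>+y. (\<lambda>z. ?K x z * F z) ((1 - t) *\<^sub>R x + t *\<^sub>R y) \<partial>lborel)"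
      using t by (intro nn_integral_cong) (simp add: algebra_simps)
    also have "\<dots> = ennreal (1 / t\<^sup>2) * (\<integral>\<^sup>+z. ?K x z * F z \<partial>lborel)"
      using t by (subst nn_integral_affine) auto
    finally show "(\<integral>\<^sup>+y. indicator B y * F (x + t *\<^sub>R (y - x)) \<partial>lborel)
       = ennreal (1 / t\<^sup>2) * (\<integral>\<^sup>+z. ?K x z * F z \<partial>lborel)" .
  qed
  also have "\<dots> = ennreal (1 / t\<^sup>2) * (\<integral>\<^sup>+x. \<integral>\<^sup>+z. ?K x z * F z \<partial>lborel \<partial>\<mu>)"
    by (intro nn_integral_cmult) measurable
  finally have conv: "(\<integral>\<^sup>+x. \<integral>\<^sup>+y. indicator B y * F (x + t *\<^sub>R (y - x)) \<partial>lborel \<partial>\<mu>)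
      = ennreal (1 / t\<^sup>2) * (\<integral>\<^sup>+x. \<integral>\<^sup>+z. ?K x z * F z \<partial>lborel \<partial>\<mu>)" .
  have "(\<integral>\<^sup>+x. \<integral>\<^sup>+z. ?K x z * F z \<partial>lborel \<partial>\<mu>) = (\<integral>\<^sup>+z. \<integral>\<^sup>+x. ?K x z * F z \<partial>\<mu> \<partial>lborel)"
    by (rule Fubini'[symmetric]) measurable
  also have "\<dots> \<le> (\<integral>\<^sup>+z. ennreal (2 * A * h * t) * F z \<partial>lborel)"
  proof (rule nn_integral_mono)
    fix z
    have eq: "(1 / t) *\<^sub>R (z - (1 - t) *\<^sub>R x) \<in> B \<Longrightarrow>
        x \<in> cball ((1 / (1 - t)) *\<^sub>R (z - t *\<^sub>R c)) (t * r / (1 - t))" for x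
    proof -
      assume *: "(1 / t) *\<^sub>R (z - (1 - t) *\<^sub>R x) \<in> B"
      have "(1 / (1 - t)) *\<^sub>R (z - t *\<^sub>R c) - x = (t / (1 - t)) *\<^sub>R ((1 / t) *\<^sub>R (z - (1 - t) *\<^sub>R x) - c)"
        using t by (simp add: scaleR_diff_right)
      then have "dist ((1 / (1 - t)) *\<^sub>R (z - t *\<^sub>R c)) x
          = (t / (1 - t)) * dist c ((1 / t) *\<^sub>R (z - (1 - t) *\<^sub>R x))"
        using t by (simp add: dist_norm norm_minus_commute)
      also have "\<dots> \<le> (t / (1 - t)) * r"
        using subsetD[OF B_sub *] t by (intro mult_left_mono) simp_all
      finally show ?thesis by simp
    qed
    have "(\<integral>\<^sup>+x. ?K x z * F z \<partial>\<mu>) = (\<integral>\<^sup>+x. ?K x z \<partial>\<mu>) * F z"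
      by (intro nn_integral_multc) measurable
    also have "(\<integral>\<^sup>+x. ?K x z \<partial>\<mu>) \<le> ennreal (2 * A * h * t)"
    \<comment> \<open>The radius \<open>t r / (1 - t)\<close> degenerates as \<open>t\<close> tends to 1; there the total mass is a better bound.\<close>
    proof (cases "t \<le> 1 / 2")
      case True
      have "(\<integral>\<^sup>+x. ?K x z \<partial>\<mu>) \<le> (\<integral>\<^sup>+x. indicator (cball ((1 / (1 - t)) *\<^sub>R (z - t *\<^sub>R c)) (t * r / (1 - t))) x \<partial>\<mu>)"
        by (intro nn_integral_mono) (simp add: indicator_def eq del: mem_cball)
      also have "\<dots> = emeasure \<mu> (cball ((1 / (1 - t)) *\<^sub>R (z - t *\<^sub>R c)) (t * r / (1 - t)))"
        by (rule nn_integral_indicator) measurable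
      also have "\<dots> \<le> ennreal (A * (t * r / (1 - t)))"
        using t r by (intro growth) simp
      also have "\<dots> \<le> ennreal (2 * A * h * t)"
      proof -
        have "t * r / (1 - t) \<le> t * h / (1 / 2)"
          using True t r by (intro frac_le mult_left_mono) auto
        then have "A * (t * r / (1 - t)) \<le> A * (t * h / (1 / 2))"
          using A by (rule mult_left_mono)
        then show ?thesis by (intro ennreal_leI) (simp add: algebra_simps)
      qed
      finally show ?thesis .
    next
      case False
      have "(\<integral>\<^sup>+x. ?K x z \<partial>\<mu>) \<le> (\<integral>\<^sup>+x. indicator UNIV x \<partial>\<mu>)"
        by (intro nn_integral_mono) (auto simp: indicator_def)
      also have "\<dots> = emeasure \<mu> UNIV"
        by (rule nn_integral_indicator) (simp add: sets)
      also note total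
      also have "ennreal (A * h) \<le> ennreal (2 * A * h * t)"
      proof -
        have "(A * h) * 1 \<le> (A * h) * (2 * t)"
          using False A r by (intro mult_left_mono) auto
        then show ?thesis by (intro ennreal_leI) (simp add: algebra_simps)
      qed
      finally show ?thesis .
    qed
    finally show "(\<integral>\<^sup>+x. ?K x z * F z \<partial>\<mu>) \<le> ennreal (2 * A * h * t) * F z"
      by (simp add: mult_right_mono)
  qed
  also have "\<dots> = ennreal (2 * A * h * t) * (\<integral>\<^sup>+z. F z \<partial>lborel)"
    by (intro nn_integral_cmult) measurable
  finally have "ennreal (1 / t\<^sup>2) * (\<integral>\<^sup>+x. \<integral>\<^sup>+z. ?K x z * F z \<partial>lborel \<partial>\<mu>)
      \<le> (ennreal (1 / t\<^sup>2) * ennreal (2 * A * h * t)) * (\<integral>\<^sup>+z. F z \<partial>lborel)"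
    unfolding mult.assoc by (rule mult_left_mono) simp
  also have "ennreal (1 / t\<^sup>2) * ennreal (2 * A * h * t) = ennreal (1 / t\<^sup>2 * (2 * A * h * t))"
    using t A r by (intro ennreal_mult[symmetric]) auto
  also have "1 / t\<^sup>2 * (2 * A * h * t) = 2 * A * h / t"
    using t by (simp add: power2_eq_square)
  finally show ?thesis unfolding conv .
qed

text \<open>The square of \<open>w x - w y\<close> is bounded by an integral over the path parameter \<open>s\<close>, with weight
  \<open>4 s\<^sup>2 h\<^sup>2\<close>. After exchanging integrals, the preceding lemma with \<open>t = s\<^sup>2\<close> contributes \<open>2 A h / s\<^sup>2\<close>.
  The powers of \<open>s\<close> cancel, and no singularity is left at \<open>s = 0\<close>.\<close>

lemma potential_estimate:
  fixes w :: "real^2 \<Rightarrow> real" and \<gamma> :: "real^2 \<Rightarrow> real^2" and \<mu> :: "(real^2) measure"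
  assumes deriv: "\<And>p d s. ((\<lambda>s. w (p + s *\<^sub>R d)) has_field_derivative (\<gamma> (p + s *\<^sub>R d) \<bullet> d)) (at s)"
    and cont: "continuous_on UNIV \<gamma>"
    and sets [measurable_cong]: "sets \<mu> = sets borel" and sf: "sigma_finite_measure \<mu>"
    and supp: "AE x in \<mu>. x \<in> closure S"
    and growth: "\<And>p R. R > 0 \<Longrightarrow> emeasure \<mu> (cball p R) \<le> ennreal (A * R)"
    and total: "emeasure \<mu> UNIV \<le> ennreal (A * h)"
    and A: "A \<ge> 0" and r: "0 < r" "r \<le> h"
    and B [measurable]: "B \<in> sets borel" and B_sub: "B \<subseteq> cball c r"
    and S: "open S" and diam: "\<And>x y. x \<in> closure S \<Longrightarrow> y \<in> B \<Longrightarrow> dist x y \<le> h"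
    and star: "\<And>x y t. x \<in> closure S \<Longrightarrow> y \<in> B \<Longrightarrow> 0 < t \<Longrightarrow> t \<le> 1 \<Longrightarrow> x + t *\<^sub>R (y - x) \<in> S"
  shows "(\<integral>\<^sup>+x. \<integral>\<^sup>+y. indicator B y * ennreal ((w x - w y)\<^sup>2) \<partial>lborel \<partial>\<mu>)
           \<le> ennreal (8 * A * h ^ 3) * (\<integral>\<^sup>+z. indicator S z * ennreal ((norm (\<gamma> z))\<^sup>2) \<partial>lborel)"
proof -
  interpret sigma_finite_measure \<mu> by fact
  interpret m: pair_sigma_finite \<mu> lborel ..
  have [measurable]: "\<gamma> \<in> borel_measurable borel" using cont by (rule borel_measurable_continuous_onI)
  have [measurable]: "S \<in> sets borel" using S by simp
  define F where "F z = indicator S z * ennreal ((norm (\<gamma> z))\<^sup>2)" for z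
  have [measurable]: "F \<in> borel_measurable borel" unfolding F_def by measurable
  let ?W = "\<lambda>s::real. indicator {0..1} s * ennreal (4 * s\<^sup>2 * h\<^sup>2) :: ennreal"
  have "(\<integral>\<^sup>+x. \<integral>\<^sup>+y. indicator B y * ennreal ((w x - w y)\<^sup>2) \<partial>lborel \<partial>\<mu>)
      \<le> (\<integral>\<^sup>+x. \<integral>\<^sup>+y. \<integral>\<^sup>+s. ?W s * (indicator B y * F (x + s\<^sup>2 *\<^sub>R (y - x))) \<partial>lborel \<partial>lborel \<partial>\<mu>)"
  proof (rule nn_integral_mono_AE, use supp in eventually_elim, rule nn_integral_mono)
    fix x y assume x: "x \<in> closure S"
    show "indicator B y * ennreal ((w x - w y)\<^sup>2)
       \<le> (\<integral>\<^sup>+s. ?W s * (indicator B y * F (x + s\<^sup>2 *\<^sub>R (y - x))) \<partial>lborel)"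
    proof (cases "y \<in> B")
      case True
      have "ennreal ((w x - w y)\<^sup>2) \<le> (\<integral>\<^sup>+s. indicator {0..1} s *
         ennreal (4 * s\<^sup>2 * (norm (y - x))\<^sup>2 * (norm (\<gamma> (x + s\<^sup>2 *\<^sub>R (y - x))))\<^sup>2) \<partial>lborel)"
        by (rule square_difference_le_path_integral[OF deriv cont])
      also have "\<dots> \<le> (\<integral>\<^sup>+s. ?W s * F (x + s\<^sup>2 *\<^sub>R (y - x)) \<partial>lborel)"
      proof (rule nn_integral_mono)
        fix s :: real
        show "indicator {0..1} s * ennreal (4 * s\<^sup>2 * (norm (y - x))\<^sup>2 * (norm (\<gamma> (x + s\<^sup>2 *\<^sub>R (y - x))))\<^sup>2)
           \<le> ?W s * F (x + s\<^sup>2 *\<^sub>R (y - x))"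
        proof (cases "0 < s \<and> s \<le> 1")
          case s: True
          then have "x + s\<^sup>2 *\<^sub>R (y - x) \<in> S"
            using star[OF x True, of "s\<^sup>2"] by (simp add: power_le_one)
          moreover have "4 * s\<^sup>2 * (norm (y - x))\<^sup>2 * (norm (\<gamma> (x + s\<^sup>2 *\<^sub>R (y - x))))\<^sup>2
             \<le> 4 * s\<^sup>2 * h\<^sup>2 * (norm (\<gamma> (x + s\<^sup>2 *\<^sub>R (y - x))))\<^sup>2"
            using diam[OF x True] s by (intro mult_mono power_mono) (auto simp: dist_norm norm_minus_commute)
          ultimately show ?thesis
            using s by (simp add: F_def ennreal_mult[symmetric] ennreal_leI)
        qed (auto simp: indicator_def)
      qed
      finally show ?thesis using True by simp
    qed simp
  qed
  also have "\<dots> = (\<integral>\<^sup>+x. \<integral>\<^sup>+s. \<integral>\<^sup>+y. ?W s * (indicator B y * F (x + s\<^sup>2 *\<^sub>R (y - x))) \<partial>lborel \<partial>lborel \<partial>\<mu>)"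
    by (intro nn_integral_cong lborel_pair.Fubini') measurable
  also have "\<dots> = (\<integral>\<^sup>+s. \<integral>\<^sup>+x. \<integral>\<^sup>+y. ?W s * (indicator B y * F (x + s\<^sup>2 *\<^sub>R (y - x))) \<partial>lborel \<partial>\<mu> \<partial>lborel)"
    by (rule m.Fubini'[symmetric]) measurable
  also have "\<dots> \<le> (\<integral>\<^sup>+s. indicator {0..1::real} s * ennreal (8 * A * h ^ 3) * (\<integral>\<^sup>+z. F z \<partial>lborel) \<partial>lborel)"
  proof (rule nn_integral_mono_AE, use AE_lborel_singleton[of "1::real"] in eventually_elim)
    fix s :: real assume "s \<noteq> 1"
    have "(\<integral>\<^sup>+x. \<integral>\<^sup>+y. ?W s * (indicator B y * F (x + s\<^sup>2 *\<^sub>R (y - x))) \<partial>lborel \<partial>\<mu>)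
        = ?W s * (\<integral>\<^sup>+x. \<integral>\<^sup>+y. indicator B y * F (x + s\<^sup>2 *\<^sub>R (y - x)) \<partial>lborel \<partial>\<mu>)"
      by (subst nn_integral_cmult, measurable)+
    also have "\<dots> \<le> indicator {0..1} s * ennreal (8 * A * h ^ 3) * (\<integral>\<^sup>+z. F z \<partial>lborel)"
    proof (cases "0 < s \<and> s < 1")
      case True
      then have "?W s * (\<integral>\<^sup>+x. \<integral>\<^sup>+y. indicator B y * F (x + s\<^sup>2 *\<^sub>R (y - x)) \<partial>lborel \<partial>\<mu>)
         \<le> ?W s * (ennreal (2 * A * h / s\<^sup>2) * (\<integral>\<^sup>+z. F z \<partial>lborel))"
        by (intro mult_left_mono nn_integral_contraction_le[OF sets sf growth total A r B B_sub])
           (auto simp: power_less_one_iff)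
      also have "\<dots> = indicator {0..1} s * (ennreal (4 * s\<^sup>2 * h\<^sup>2) * ennreal (2 * A * h / s\<^sup>2)) * (\<integral>\<^sup>+z. F z \<partial>lborel)"
        by (simp only: mult.assoc)
      also have "ennreal (4 * s\<^sup>2 * h\<^sup>2) * ennreal (2 * A * h / s\<^sup>2) = ennreal (4 * s\<^sup>2 * h\<^sup>2 * (2 * A * h / s\<^sup>2))"
        using A r by (intro ennreal_mult[symmetric]) auto
      also have "4 * s\<^sup>2 * h\<^sup>2 * (2 * A * h / s\<^sup>2) = 8 * A * h ^ 3"
        using True by (simp add: power2_eq_square power3_eq_cube)
      finally show ?thesis .
    qed (use \<open>s \<noteq> 1\<close> in \<open>auto simp: indicator_def\<close>)
    finally show "(\<integral>\<^sup>+x. \<integral>\<^sup>+y. ?W s * (indicator B y * F (x + s\<^sup>2 *\<^sub>R (y - x))) \<partial>lborel \<partial>\<mu>)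
        \<le> indicator {0..1} s * ennreal (8 * A * h ^ 3) * (\<integral>\<^sup>+z. F z \<partial>lborel)" .
  qed
  also have "\<dots> = ennreal (8 * A * h ^ 3) * (\<integral>\<^sup>+z. F z \<partial>lborel)"
    by (simp add: mult.assoc nn_integral_multc)
  finally show ?thesis by (simp add: F_def)
qed

section \<open>Mollification of functions with a weak gradient\<close>

text \<open>Needed for Tonelli's theorem, because weak gradients are only Lebesgue measurable.\<close>

lemma sigma_finite_lebesgue: "sigma_finite_measure (lebesgue :: 'a::euclidean_space measure)"
proof
  obtain A :: "'a set set" where A: "countable A" "A \<subseteq> sets lborel" "\<Union>A = space lborel"
    "\<forall>a\<in>A. emeasure lborel a \<noteq> \<infinity>"
    using lborel.sigma_finite_countable by blast
  then show "\<exists>A::'a set set. countable A \<and> A \<subseteq> sets lebesgue \<and> \<Union>A = space lebesgue \<and>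
      (\<forall>a\<in>A. emeasure lebesgue a \<noteq> \<infinity>)"
    by (intro exI[of _ A]) (auto simp: subset_iff sets_completionI_sets)
qed

lemma bump_minus: "bump \<epsilon> (- x) = bump \<epsilon> x"
  by (simp add: bump_def)

lemma bump_le_1: "bump \<epsilon> x \<le> 1"
  by (simp add: bump_def bump_profile_def)

lemma bump_outside:
  assumes "\<epsilon> > 0" "cball p \<epsilon> \<subseteq> T" "y \<notin> T"
  shows "bump \<epsilon> (p - y) = 0" "bump_grad \<epsilon> (p - y) = 0"
proof -
  have "y \<notin> cball p \<epsilon>" using assms by blast
  then have "norm (p - y) \<ge> \<epsilon>" by (simp add: dist_norm)
  then show "bump \<epsilon> (p - y) = 0" "bump_grad \<epsilon> (p - y) = 0"
    using assms(1) bump_eq_0 bump_grad_eq_0 by blast+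
qed

lemma borel_measurable_bump [measurable]: "bump \<epsilon> \<in> borel_measurable borel"
  by (intro borel_measurable_continuous_onI continuous_intros)

definition bump_mass :: "real \<Rightarrow> real" where
  "bump_mass \<epsilon> = enn2real (\<integral>\<^sup>+z. ennreal (bump \<epsilon> z) \<partial>lborel)"

lemma nn_integral_bump:
  assumes "\<epsilon> > 0"
  shows "(\<integral>\<^sup>+z. ennreal (bump \<epsilon> z) \<partial>lborel) = ennreal (bump_mass \<epsilon>)" and "bump_mass \<epsilon> > 0"
proof -
  have "(\<integral>\<^sup>+z. ennreal (bump \<epsilon> z) \<partial>lborel) \<le> (\<integral>\<^sup>+z. indicator (cball 0 \<epsilon>) z \<partial>(lborel::(real^2) measure))"
    using bump_eq_0[OF assms] bump_le_1[of \<epsilon>]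
    by (intro nn_integral_mono) (auto simp: indicator_def not_le)
  also have "\<dots> = emeasure lborel (cball (0::real^2) \<epsilon>)" by (simp add: nn_integral_indicator)
  also have "\<dots> < \<infinity>" by (rule emeasure_lborel_cball_finite)
  finally have fin: "(\<integral>\<^sup>+z. ennreal (bump \<epsilon> z) \<partial>lborel) < \<infinity>" .
  then show "(\<integral>\<^sup>+z. ennreal (bump \<epsilon> z) \<partial>lborel) = ennreal (bump_mass \<epsilon>)"
    by (simp add: bump_mass_def)
  have "(\<integral>\<^sup>+z. ennreal (bump \<epsilon> z) \<partial>lborel) \<noteq> 0"
  proof
    assume "(\<integral>\<^sup>+z. ennreal (bump \<epsilon> z) \<partial>lborel) = 0"
    then have "AE z in lborel. bump \<epsilon> z = 0"
      by (subst (asm) nn_integral_0_iff_AE) (auto simp: bump_nonneg ennreal_eq_0_iff order.antisym)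
    moreover have "{z \<in> space lborel. \<not> bump \<epsilon> z = 0} = ball 0 \<epsilon>"
    proof -
      have "\<not> bump \<epsilon> z = 0 \<longleftrightarrow> norm z < \<epsilon>" for z
        using bump_pos_iff[OF assms, of z] bump_nonneg[of \<epsilon> z] by linarith
      then show ?thesis unfolding set_eq_iff by simp
    qed
    ultimately have "emeasure lborel (ball (0::real^2) \<epsilon>) = 0"
      using AE_iff_measurable[of "ball 0 \<epsilon>" lborel "\<lambda>z. bump \<epsilon> z = 0"] by simp
    then have "ennreal (unit_ball_vol 2 * \<epsilon>\<^sup>2) = 0" using assms by (simp add: emeasure_ball)
    then have "unit_ball_vol 2 * \<epsilon>\<^sup>2 \<le> 0" by (simp only: ennreal_eq_0_iff)
    moreover have "0 < unit_ball_vol 2 * \<epsilon>\<^sup>2" using assms by (intro mult_pos_pos) simp_all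
    ultimately show False by linarith
  qed
  then show "bump_mass \<epsilon> > 0"
    using fin by (simp add: bump_mass_def enn2real_positive_iff zero_less_iff_neq_zero)
qed

lemma nn_integral_bump_translate:
  assumes "\<epsilon> > 0"
  shows "(\<integral>\<^sup>+y. ennreal (bump \<epsilon> (p - y)) \<partial>lborel) = ennreal (bump_mass \<epsilon>)"
proof -
  have "(\<integral>\<^sup>+y. ennreal (bump \<epsilon> (p - y)) \<partial>lborel) = (\<integral>\<^sup>+y. ennreal (bump \<epsilon> (- p + 1 *\<^sub>R y)) \<partial>lborel)"
    using bump_minus by (intro nn_integral_cong) (metis diff_conv_add_uminus minus_diff_eq scaleR_one add.commute)
  also have "\<dots> = (\<integral>\<^sup>+z. ennreal (bump \<epsilon> z) \<partial>lborel)"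
    by (subst nn_integral_affine) auto
  finally show ?thesis by (simp add: nn_integral_bump[OF assms])
qed

text \<open>\<open>V\<close> is continuous on the whole plane and the mollified function integrates over a fixed box, so
  that it may be differentiated under the integral sign everywhere. It approximates \<open>V\<close>, and its
  gradient is controlled by \<open>g\<close>, only at points whose closed \<open>\<epsilon>\<close>-ball lies in \<open>S\<close>.\<close>

locale mollification =
  fixes S :: "(real^2) set" and a b :: "real^2" and V :: "real^2 \<Rightarrow> real"
    and g :: "real^2 \<Rightarrow> real^2" and \<epsilon> :: real
  assumes open_S: "open S" and S_sub: "S \<subseteq> cbox a b"
    and cont_V: "continuous_on UNIV V" and weak: "L2_weak_gradient S V g" and eps: "\<epsilon> > 0"
begin

abbreviation "m \<equiv> bump_mass \<epsilon>"

lemmas m_pos = nn_integral_bump(2)[OF eps]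

definition smoothed :: "real^2 \<Rightarrow> real" where
  "smoothed p = (1 / m) * integral (cbox a b) (\<lambda>y. V y * bump \<epsilon> (p - y))"

definition smoothed_grad :: "real^2 \<Rightarrow> real^2" where
  "smoothed_grad p = (1 / m) *\<^sub>R integral (cbox a b) (\<lambda>y. V y *\<^sub>R bump_grad \<epsilon> (p - y))"

lemma cont_V' [continuous_intros]: "continuous_on A q \<Longrightarrow> continuous_on A (\<lambda>x. V (q x))"
  using continuous_on_compose2[OF cont_V] by simp

lemma smoothed_derivative:
  "((\<lambda>s. smoothed (p + s *\<^sub>R d)) has_field_derivative (smoothed_grad (p + s *\<^sub>R d) \<bullet> d)) (at s)"
proof -
  let ?f = "\<lambda>s y. V y * bump \<epsilon> (p + s *\<^sub>R d - y)"
  let ?f' = "\<lambda>s y. V y * (bump_grad \<epsilon> (p + s *\<^sub>R d - y) \<bullet> d)"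
  have "((\<lambda>s. integral (cbox a b) (?f s)) has_field_derivative integral (cbox a b) (?f' s)) (at s within UNIV)"
  proof (rule leibniz_rule_field_derivative)
    fix s :: real and y
    have "((\<lambda>s. p + s *\<^sub>R d - y) has_derivative (\<lambda>t. t *\<^sub>R d)) (at s)"
      by (auto intro!: derivative_eq_intros)
    from has_derivative_compose[OF this bump_has_derivative, of \<epsilon>]
    have "((\<lambda>s. bump \<epsilon> (p + s *\<^sub>R d - y)) has_field_derivative (bump_grad \<epsilon> (p + s *\<^sub>R d - y) \<bullet> d)) (at s)"
      by (rule has_derivative_imp_has_field_derivative) simp
    then show "((\<lambda>s. ?f s y) has_field_derivative ?f' s y) (at s within UNIV)"
      by (intro DERIV_cmult) simp
  next
    show "?f s integrable_on cbox a b" for s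
      by (intro integrable_continuous continuous_intros)
    show "continuous_on (UNIV \<times> cbox a b) (\<lambda>(s, y). ?f' s y)"
      unfolding case_prod_beta by (intro continuous_intros)
  qed auto
  then have "((\<lambda>s. smoothed (p + s *\<^sub>R d)) has_field_derivative (1 / m) * integral (cbox a b) (?f' s)) (at s)"
    unfolding smoothed_def by (intro DERIV_cmult) simp
  also have "(1 / m) * integral (cbox a b) (?f' s) = smoothed_grad (p + s *\<^sub>R d) \<bullet> d"
  proof -
    have "(\<lambda>y. V y *\<^sub>R bump_grad \<epsilon> (p + s *\<^sub>R d - y)) integrable_on cbox a b"
      by (intro integrable_continuous continuous_intros)
    from integral_linear[OF this bounded_linear_inner_left[of d]] show ?thesis
      by (simp add: smoothed_grad_def o_def)
  qed
  finally show ?thesis .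
qed

lemma continuous_smoothed_grad: "continuous_on UNIV smoothed_grad"
  unfolding smoothed_grad_def
  by (intro continuous_intros integral_continuous_on_param) (auto simp: case_prod_beta intro!: continuous_intros)

lemma continuous_smoothed: "continuous_on UNIV smoothed"
  unfolding smoothed_def
  by (intro continuous_intros integral_continuous_on_param) (auto simp: case_prod_beta intro!: continuous_intros)

lemma integral_bump:
  assumes "cball p \<epsilon> \<subseteq> cbox a b"
  shows "((\<lambda>y. bump \<epsilon> (p - y)) has_integral m) (cbox a b)"
proof -
  let ?b = "\<lambda>y. bump \<epsilon> (p - y)"
  have int: "(?b has_integral integral (cbox a b) ?b) (cbox a b)"
    by (intro integrable_integral integrable_continuous continuous_intros)
  have "ennreal (integral (cbox a b) ?b) = (\<integral>\<^sup>+y. ennreal (?b y) * indicator (cbox a b) y \<partial>lborel)"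
    by (rule nn_integral_has_integral_lebesgue'[OF _ int, symmetric]) (simp add: bump_nonneg)
  also have "\<dots> = (\<integral>\<^sup>+y. ennreal (?b y) \<partial>lborel)"
  proof (rule nn_integral_cong)
    fix y show "ennreal (?b y) * indicator (cbox a b) y = ennreal (?b y)"
      using bump_outside(1)[OF eps assms, of y] by (cases "y \<in> cbox a b") auto
  qed
  finally have "ennreal (integral (cbox a b) ?b) = ennreal m"
    by (simp add: nn_integral_bump_translate[OF eps])
  moreover have "integral (cbox a b) ?b \<ge> 0" by (rule integral_nonneg) (use int in \<open>auto simp: bump_nonneg\<close>)
  ultimately have "integral (cbox a b) ?b = m" using m_pos by simp
  with int show ?thesis by simp
qed

lemma smoothed_approx:
  assumes sub: "cball p \<epsilon> \<subseteq> cbox a b" and near: "\<And>y. y \<in> cball p \<epsilon> \<Longrightarrow> \<bar>V y - V p\<bar> \<le> \<eta>"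
  shows "\<bar>smoothed p - V p\<bar> \<le> \<eta>"
proof -
  let ?b = "\<lambda>y. bump \<epsilon> (p - y)"
  note int_b = integral_bump[OF sub]
  have int: "((\<lambda>y. V y * ?b y) has_integral (m * smoothed p)) (cbox a b)"
    using m_pos unfolding smoothed_def
    by simp (intro integrable_integral integrable_continuous continuous_intros)
  have diff: "((\<lambda>y. V y * ?b y - V p * ?b y) has_integral (m * smoothed p - V p * m)) (cbox a b)"
    by (intro has_integral_diff int has_integral_mult_right int_b)
  have "norm (integral (cbox a b) (\<lambda>y. V y * ?b y - V p * ?b y)) \<le> integral (cbox a b) (\<lambda>y. \<eta> * ?b y)"
  proof (rule Henstock_Kurzweil_Integration.integral_norm_bound_integral)
    show "(\<lambda>y. V y * ?b y - V p * ?b y) integrable_on cbox a b" "(\<lambda>y. \<eta> * ?b y) integrable_on cbox a b"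
      using diff has_integral_mult_right[OF int_b, of \<eta>] by blast+
    fix y
    have "\<bar>V y - V p\<bar> * ?b y \<le> \<eta> * ?b y"
    proof (cases "y \<in> cball p \<epsilon>")
      case True then show ?thesis by (intro mult_right_mono near bump_nonneg)
    next
      case False
      then have "?b y = 0" by (intro bump_eq_0 eps) (auto simp: dist_norm)
      then show ?thesis by simp
    qed
    then show "norm (V y * ?b y - V p * ?b y) \<le> \<eta> * ?b y"
      by (simp add: abs_mult bump_nonneg flip: left_diff_distrib)
  qed
  then have "norm (m * smoothed p - V p * m) \<le> \<eta> * m"
    by (simp only: integral_unique[OF diff] integral_unique[OF has_integral_mult_right[OF int_b]])
  then have "m * \<bar>smoothed p - V p\<bar> \<le> m * \<eta>"
  proof -
    have "m * smoothed p - V p * m = m * (smoothed p - V p)" by (simp add: algebra_simps)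
    with \<open>norm (m * smoothed p - V p * m) \<le> \<eta> * m\<close> show ?thesis
      using m_pos by (simp add: abs_mult mult.commute)
  qed
  then show ?thesis using m_pos by simp
qed

text \<open>The reflected kernel \<open>y \<mapsto> bump \<epsilon> (p - y)\<close> is a test function on \<open>S\<close>; the weak gradient moves
  the derivative from the kernel to \<open>g\<close>.\<close>

lemma smoothed_grad_eq:
  assumes sub: "cball p \<epsilon> \<subseteq> S"
  shows "m * smoothed_grad p $ i = (LINT y:S|lebesgue. g y $ i * bump \<epsilon> (p - y))"
proof -
  let ?\<phi> = "\<lambda>y. bump \<epsilon> (p - y)"
  let ?f = "\<lambda>y. V y *\<^sub>R bump_grad \<epsilon> (p - y)"
  have "?\<phi> \<in> test_functions S" by (rule bump_translate_test_function[OF eps sub])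
  then have "(LINT y:S|lebesgue. V y * pderivative i ?\<phi> y) = - (LINT y:S|lebesgue. g y $ i * ?\<phi> y)"
    using weak by (simp add: L2_weak_gradient_def)
  then have "(LINT y:S|lebesgue. g y $ i * ?\<phi> y) = (LINT y:S|lebesgue. ?f y $ i)"
    by (simp add: pderivative_bump_translate set_lebesgue_integral_def)
  also have "\<dots> = (LINT y:cbox a b|lebesgue. ?f y $ i)"
    unfolding set_lebesgue_integral_def
  proof (rule Bochner_Integration.integral_cong)
    fix y
    have "?f y = 0" if "y \<notin> S"
      using that by (simp add: bump_outside(2)[OF eps sub])
    then show "indicat_real S y *\<^sub>R ?f y $ i = indicat_real (cbox a b) y *\<^sub>R ?f y $ i"
      using S_sub by (cases "y \<in> S") (auto simp: indicator_def)
  qed simp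
  also have "\<dots> = integral (cbox a b) (\<lambda>y. ?f y $ i)"
    by (intro set_lebesgue_integral_eq_integral(2) absolutely_integrable_continuous continuous_intros)
  also have "\<dots> = integral (cbox a b) ?f $ i"
    by (intro integral_component_eq_cart integrable_continuous continuous_intros)
  also have "\<dots> = m * smoothed_grad p $ i" using m_pos by (simp add: smoothed_grad_def)
  finally show ?thesis by simp
qed

lemma g_measurable [measurable]: "(\<lambda>y. indicator S y *\<^sub>R g y) \<in> borel_measurable lebesgue"
  using weak by (simp add: L2_weak_gradient_def L2_def set_borel_measurable_def)

lemma g_square_integrable: "integrable lebesgue (\<lambda>y. indicator S y * (norm (g y))\<^sup>2)"
  using weak by (simp add: L2_weak_gradient_def L2_def set_integrable_def)

lemma S_lebesgue [measurable]: "S \<in> sets lebesgue" using open_S by simp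

lemma bump_lebesgue [measurable]: "(\<lambda>y. bump \<epsilon> (p - y)) \<in> borel_measurable lebesgue"
  by (rule measurable_completion) measurable

text \<open>Jensen's inequality for the average of \<open>g\<close> with respect to the kernel. For each component, it is
  obtained by expanding the integral of the nonnegative function \<open>(g\<^sub>i - \<alpha>)\<^sup>2\<close> times the kernel, where
  \<open>\<alpha>\<close> is the average itself.\<close>

lemma smoothed_grad_square_le:
  assumes sub: "cball p \<epsilon> \<subseteq> S"
  shows "m * (norm (smoothed_grad p))\<^sup>2 \<le> (LINT y|lebesgue. indicator S y * (norm (g y))\<^sup>2 * bump \<epsilon> (p - y))"
    and "integrable lebesgue (\<lambda>y. indicator S y * (norm (g y))\<^sup>2 * bump \<epsilon> (p - y))"
proof -
  let ?b = "\<lambda>y. bump \<epsilon> (p - y)"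
  let ?G = "\<lambda>y. indicator S y * (norm (g y))\<^sup>2"
  have g_i [measurable]: "(\<lambda>y. indicator S y * g y $ i) \<in> borel_measurable lebesgue" for i
  proof -
    have "(\<lambda>y. (indicator S y *\<^sub>R g y) $ i) \<in> borel_measurable lebesgue"
      by (rule measurable_compose[OF g_measurable]) (intro borel_measurable_continuous_onI continuous_intros)
    then show ?thesis by simp
  qed
  show int: "integrable lebesgue (\<lambda>y. ?G y * ?b y)"
  proof (rule Bochner_Integration.integrable_bound[OF g_square_integrable])
    show "(\<lambda>y. ?G y * ?b y) \<in> borel_measurable lebesgue"
      by (rule borel_measurable_times[OF borel_measurable_integrable[OF g_square_integrable] bump_lebesgue])
    show "AE y in lebesgue. norm (?G y * ?b y) \<le> norm (?G y)"
      using bump_le_1 by (intro AE_I2) (simp add: abs_mult bump_nonneg mult_left_le)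
  qed
  have b_S: "indicator S y * ?b y = indicator (cbox a b) y * ?b y" for y
    using S_sub bump_outside(1)[OF eps sub, of y] by (cases "y \<in> S") (auto simp: indicator_def)
  have abs_b: "?b absolutely_integrable_on cbox a b"
    by (intro absolutely_integrable_continuous continuous_intros)
  have int_b: "integrable lebesgue (\<lambda>y. indicator S y * ?b y)" "(LINT y|lebesgue. indicator S y * ?b y) = m"
    using abs_b set_lebesgue_integral_eq_integral(2)[OF abs_b]
      integral_unique[OF integral_bump[OF subset_trans[OF sub S_sub]]]
    unfolding b_S by (simp_all add: set_integrable_def set_lebesgue_integral_def)
  have comp: "integrable lebesgue (\<lambda>y. indicator S y * (g y $ i)\<^sup>2 * ?b y)"
    "m * (smoothed_grad p $ i)\<^sup>2 \<le> (LINT y|lebesgue. indicator S y * (g y $ i)\<^sup>2 * ?b y)" for i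
  proof -
    let ?\<alpha> = "smoothed_grad p $ i"
    have "(\<lambda>y. (indicator S y * g y $ i)\<^sup>2 * ?b y) \<in> borel_measurable lebesgue" by measurable
    moreover have "(\<lambda>y. (indicator S y * g y $ i)\<^sup>2 * ?b y) = (\<lambda>y. indicator S y * (g y $ i)\<^sup>2 * ?b y)"
      by (auto simp: indicator_def)
    ultimately have meas2: "(\<lambda>y. indicator S y * (g y $ i)\<^sup>2 * ?b y) \<in> borel_measurable lebesgue" by simp
    have le: "(g y $ i)\<^sup>2 \<le> (norm (g y))\<^sup>2" for y
      using component_le_norm_cart[of "g y" i] by (metis abs_ge_zero power2_abs power_mono)
    show int2: "integrable lebesgue (\<lambda>y. indicator S y * (g y $ i)\<^sup>2 * ?b y)"
      by (rule Bochner_Integration.integrable_bound[OF int meas2])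
         (use le in \<open>auto simp: indicator_def bump_nonneg abs_mult intro!: mult_right_mono\<close>)
    have meas1: "(\<lambda>y. indicator S y * g y $ i * ?b y) \<in> borel_measurable lebesgue" by measurable
    have int1: "integrable lebesgue (\<lambda>y. indicator S y * g y $ i * ?b y)"
    proof (rule Bochner_Integration.integrable_bound[OF Bochner_Integration.integrable_add[OF int2 int_b(1)] meas1])
      have "\<bar>q\<bar> * \<beta> \<le> q\<^sup>2 * \<beta> + \<beta>" if "\<beta> \<ge> 0" for q \<beta> :: real
      proof -
        have "\<bar>q\<bar> \<le> q\<^sup>2 + 1"
          using zero_le_power2[of "\<bar>q\<bar> - 1"] zero_le_power2[of q] by (simp add: power2_diff)
        then have "\<bar>q\<bar> * \<beta> \<le> (q\<^sup>2 + 1) * \<beta>" using that by (rule mult_right_mono)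
        then show ?thesis by (simp add: algebra_simps)
      qed
      then show "AE y in lebesgue. norm (indicator S y * g y $ i * ?b y)
          \<le> norm (indicator S y * (g y $ i)\<^sup>2 * ?b y + indicator S y * ?b y)"
        by (intro AE_I2) (simp add: indicator_def abs_mult bump_nonneg)
    qed
    have "0 \<le> (LINT y|lebesgue. indicator S y * (g y $ i)\<^sup>2 * ?b y - (2 * ?\<alpha>) * (indicator S y * g y $ i * ?b y)
        + ?\<alpha>\<^sup>2 * (indicator S y * ?b y))"
    proof (rule Bochner_Integration.integral_nonneg)
      fix y
      have "0 \<le> indicator S y * ((g y $ i - ?\<alpha>)\<^sup>2 * ?b y)" by (simp add: bump_nonneg)
      then show "0 \<le> indicator S y * (g y $ i)\<^sup>2 * ?b y - (2 * ?\<alpha>) * (indicator S y * g y $ i * ?b y)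
        + ?\<alpha>\<^sup>2 * (indicator S y * ?b y)"
        by (simp add: power2_eq_square algebra_simps)
    qed
    also have "\<dots> = (LINT y|lebesgue. indicator S y * (g y $ i)\<^sup>2 * ?b y)
        - (2 * ?\<alpha>) * (LINT y|lebesgue. indicator S y * g y $ i * ?b y) + ?\<alpha>\<^sup>2 * m"
      using int2 int1 int_b by simp
    also have "(LINT y|lebesgue. indicator S y * g y $ i * ?b y) = m * ?\<alpha>"
      by (simp add: smoothed_grad_eq[OF sub] set_lebesgue_integral_def mult.assoc)
    finally show "m * ?\<alpha>\<^sup>2 \<le> (LINT y|lebesgue. indicator S y * (g y $ i)\<^sup>2 * ?b y)"
      by (simp add: power2_eq_square algebra_simps)
  qed
  have norm2: "(norm x)\<^sup>2 = (x $ 1)\<^sup>2 + (x $ 2)\<^sup>2" for x :: "real^2"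
    unfolding power2_norm_eq_inner inner_vec_def by (simp add: sum_2 power2_eq_square)
  have "m * (norm (smoothed_grad p))\<^sup>2 \<le> (LINT y|lebesgue. indicator S y * (g y $ 1)\<^sup>2 * ?b y)
      + (LINT y|lebesgue. indicator S y * (g y $ 2)\<^sup>2 * ?b y)"
    using comp(2)[of 1] comp(2)[of 2] by (simp add: norm2 distrib_left)
  also have "\<dots> = (LINT y|lebesgue. ?G y * ?b y)"
    by (subst Bochner_Integration.integral_add[OF comp(1) comp(1), symmetric])
       (simp add: norm2 distrib_left distrib_right)
  finally show "m * (norm (smoothed_grad p))\<^sup>2 \<le> (LINT y|lebesgue. ?G y * ?b y)" .
qed

text \<open>The function \<open>x \<mapsto> smoothed (q + \<kappa> x)\<close> has the gradient that appears here. Integrating the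
  pointwise bound over \<open>x\<close> with Tonelli's theorem leaves the integral of the kernel, which is
  \<open>m / \<kappa>\<^sup>2\<close>; in the plane, this cancels the chain rule factor \<open>\<kappa>\<^sup>2\<close> exactly.\<close>

lemma smoothed_grad_contracted_le:
  assumes lam: "0 < \<kappa>" and A [measurable]: "A \<in> sets borel"
    and sub: "\<And>x. x \<in> A \<Longrightarrow> cball (q + \<kappa> *\<^sub>R x) \<epsilon> \<subseteq> S"
  shows "(\<integral>\<^sup>+x. indicator A x * ennreal ((norm (\<kappa> *\<^sub>R smoothed_grad (q + \<kappa> *\<^sub>R x)))\<^sup>2) \<partial>lborel)
     \<le> (\<integral>\<^sup>+y. ennreal (indicator S y * (norm (g y))\<^sup>2) \<partial>lebesgue)"
proof -
  interpret l: sigma_finite_measure "lebesgue :: (real^2) measure" by (rule sigma_finite_lebesgue)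
  interpret p: pair_sigma_finite "lborel :: (real^2) measure" "lebesgue :: (real^2) measure" ..
  let ?G = "\<lambda>y. ennreal (indicator S y * (norm (g y))\<^sup>2)"
  have [measurable]: "?G \<in> borel_measurable lebesgue"
    using g_square_integrable by measurable
  have id [measurable]: "(\<lambda>y. y) \<in> lebesgue \<rightarrow>\<^sub>M (borel :: (real^2) measure)"
    by (rule measurable_completion) simp
  have joint [measurable]: "(\<lambda>(x, y). ennreal (bump \<epsilon> (q + \<kappa> *\<^sub>R x - y))) \<in> borel_measurable (lborel \<Otimes>\<^sub>M lebesgue)"
  proof -
    have "(\<lambda>z. snd z) \<in> (lborel \<Otimes>\<^sub>M lebesgue) \<rightarrow>\<^sub>M (borel :: (real^2) measure)"
      by (rule measurable_compose[OF measurable_snd id])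
    moreover have "(\<lambda>z. fst z) \<in> (lborel \<Otimes>\<^sub>M lebesgue) \<rightarrow>\<^sub>M (borel :: (real^2) measure)"
      by (rule measurable_compose[OF measurable_fst]) simp
    ultimately show ?thesis unfolding case_prod_beta by measurable
  qed
  have pt: "indicator A x * ennreal ((norm (\<kappa> *\<^sub>R smoothed_grad (q + \<kappa> *\<^sub>R x)))\<^sup>2)
      \<le> ennreal (\<kappa>\<^sup>2 / m) * (\<integral>\<^sup>+y. ?G y * ennreal (bump \<epsilon> (q + \<kappa> *\<^sub>R x - y)) \<partial>lebesgue)" for x
  proof (cases "x \<in> A")
    case True
    let ?p = "q + \<kappa> *\<^sub>R x"
    let ?I = "LINT y|lebesgue. indicator S y * (norm (g y))\<^sup>2 * bump \<epsilon> (?p - y)"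
    note le = smoothed_grad_square_le[OF sub[OF True]]
    have "(norm (\<kappa> *\<^sub>R smoothed_grad ?p))\<^sup>2 = \<kappa>\<^sup>2 / m * (m * (norm (smoothed_grad ?p))\<^sup>2)"
      using m_pos by (simp add: power_mult_distrib)
    also have "\<dots> \<le> \<kappa>\<^sup>2 / m * ?I"
      using le(1) m_pos by (intro mult_left_mono) auto
    finally have "ennreal ((norm (\<kappa> *\<^sub>R smoothed_grad ?p))\<^sup>2) \<le> ennreal (\<kappa>\<^sup>2 / m * ?I)"
      by (rule ennreal_leI)
    also have "\<dots> = ennreal (\<kappa>\<^sup>2 / m) * ennreal ?I"
      using m_pos by (intro ennreal_mult' ) simp
    also have "ennreal ?I = (\<integral>\<^sup>+y. ennreal (indicator S y * (norm (g y))\<^sup>2 * bump \<epsilon> (?p - y)) \<partial>lebesgue)"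
      by (rule nn_integral_eq_integral[OF le(2), symmetric]) (simp add: bump_nonneg)
    also have "\<dots> = (\<integral>\<^sup>+y. ?G y * ennreal (bump \<epsilon> (?p - y)) \<partial>lebesgue)"
      by (intro nn_integral_cong ennreal_mult) (simp_all add: bump_nonneg)
    finally show ?thesis using True by simp
  qed simp
  have "(\<integral>\<^sup>+x. indicator A x * ennreal ((norm (\<kappa> *\<^sub>R smoothed_grad (q + \<kappa> *\<^sub>R x)))\<^sup>2) \<partial>lborel)
     \<le> (\<integral>\<^sup>+x. ennreal (\<kappa>\<^sup>2 / m) * (\<integral>\<^sup>+y. ?G y * ennreal (bump \<epsilon> (q + \<kappa> *\<^sub>R x - y)) \<partial>lebesgue) \<partial>lborel)"
    by (intro nn_integral_mono pt)
  also have "\<dots> = ennreal (\<kappa>\<^sup>2 / m) * (\<integral>\<^sup>+x. (\<integral>\<^sup>+y. ?G y * ennreal (bump \<epsilon> (q + \<kappa> *\<^sub>R x - y)) \<partial>lebesgue) \<partial>lborel)"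
    by (intro nn_integral_cmult) measurable
  also have "(\<integral>\<^sup>+x. (\<integral>\<^sup>+y. ?G y * ennreal (bump \<epsilon> (q + \<kappa> *\<^sub>R x - y)) \<partial>lebesgue) \<partial>lborel)
     = (\<integral>\<^sup>+y. (\<integral>\<^sup>+x. ?G y * ennreal (bump \<epsilon> (q + \<kappa> *\<^sub>R x - y)) \<partial>lborel) \<partial>lebesgue)"
    by (rule p.Fubini'[symmetric]) measurable
  also have "\<dots> = (\<integral>\<^sup>+y. ?G y * ennreal (m / \<kappa>\<^sup>2) \<partial>lebesgue)"
  proof (rule nn_integral_cong)
    fix y
    have "(\<integral>\<^sup>+x. ?G y * ennreal (bump \<epsilon> (q + \<kappa> *\<^sub>R x - y)) \<partial>lborel)
        = ?G y * (\<integral>\<^sup>+x. ennreal (bump \<epsilon> ((q - y) + \<kappa> *\<^sub>R x)) \<partial>lborel)"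
      by (subst nn_integral_cmult) (simp_all add: algebra_simps)
    also have "(\<integral>\<^sup>+x. ennreal (bump \<epsilon> ((q - y) + \<kappa> *\<^sub>R x)) \<partial>lborel) = ennreal (1 / \<kappa>\<^sup>2) * ennreal m"
      using lam by (subst nn_integral_affine) (simp_all add: nn_integral_bump[OF eps])
    also have "\<dots> = ennreal (m / \<kappa>\<^sup>2)"
      using m_pos by (simp flip: ennreal_mult)
    finally show "(\<integral>\<^sup>+x. ?G y * ennreal (bump \<epsilon> (q + \<kappa> *\<^sub>R x - y)) \<partial>lborel) = ?G y * ennreal (m / \<kappa>\<^sup>2)" .
  qed
  also have "\<dots> = (\<integral>\<^sup>+y. ?G y \<partial>lebesgue) * ennreal (m / \<kappa>\<^sup>2)"
    by (intro nn_integral_multc) measurable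
  also have "ennreal (\<kappa>\<^sup>2 / m) * \<dots> = (\<integral>\<^sup>+y. ?G y \<partial>lebesgue) * (ennreal (\<kappa>\<^sup>2 / m) * ennreal (m / \<kappa>\<^sup>2))"
    by (simp only: mult_ac)
  also have "ennreal (\<kappa>\<^sup>2 / m) * ennreal (m / \<kappa>\<^sup>2) = ennreal (\<kappa>\<^sup>2 / m * (m / \<kappa>\<^sup>2))"
    using m_pos by (intro ennreal_mult[symmetric]) auto
  also have "\<kappa>\<^sup>2 / m * (m / \<kappa>\<^sup>2) = 1" using m_pos lam by simp
  finally show ?thesis by simp
qed

end

section \<open>Geometry of star-shaped polygons\<close>

text \<open>The path along the edges \<open>0, \<dots>, k\<close>. It is an arc as long as it does not close up, and all edges
  together form a simple closed path.\<close>

fun chain :: "polygon \<Rightarrow> nat \<Rightarrow> real \<Rightarrow> real^2" where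
  "chain P 0 = linepath (vertex P 0) (vertex P 1)"
| "chain P (Suc k) = chain P k +++ linepath (vertex P (Suc k)) (vertex P (Suc (Suc k)))"

lemma pathstart_chain [simp]: "pathstart (chain P k) = vertex P 0"
  by (induction k) auto

lemma pathfinish_chain [simp]: "pathfinish (chain P k) = vertex P (Suc k)"
  by (cases k) auto

lemma path_image_chain: "path_image (chain P k) = (\<Union>i\<le>k. edge P i)"
  by (induction k) (auto simp: path_image_join edge_def atMost_Suc)

lemma vertex_inj:
  assumes "simple_polygon P" "i < length P" "j < length P"
  shows "vertex P i = vertex P j \<longleftrightarrow> i = j"
  using assms by (simp add: vertex_def simple_polygon_def nth_eq_iff_index_eq)

lemma vertex_length [simp]: "vertex P (length P) = vertex P 0"
  by (simp add: vertex_def)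

lemma edge_Int_edge:
  assumes "simple_polygon P" "i < length P" "j < length P" "i \<noteq> j"
  shows "edge P i \<inter> edge P j = {vertex P i, vertex P (Suc i)} \<inter> {vertex P j, vertex P (Suc j)}"
  using assms by (auto simp: simple_polygon_def)

lemma arc_chain:
  assumes P: "simple_polygon P" and "Suc k < length P"
  shows "arc (chain P k)"
  using assms(2)
proof (induction k)
  case 0
  then show ?case using vertex_inj[OF P, of 0 1] by (cases P) (simp_all add: arc_linepath)
next
  case (Suc k)
  have "edge P i \<inter> edge P (Suc k) \<subseteq> {vertex P (Suc k)}" if "i \<le> k" for i
    using that Suc.prems vertex_inj[OF P]
    by (subst edge_Int_edge[OF P]) auto
  then have "path_image (chain P k) \<inter> edge P (Suc k) \<subseteq> {vertex P (Suc k)}"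
    unfolding path_image_chain by blast
  then show ?case
    using Suc vertex_inj[OF P, of "Suc k" "Suc (Suc k)"]
    by (auto intro!: arc_join simp: edge_def)
qed

lemma simple_path_chain:
  assumes P: "simple_polygon P"
  shows "simple_path (chain P (length P - 1))"
    and "pathfinish (chain P (length P - 1)) = pathstart (chain P (length P - 1))"
    and "path_image (chain P (length P - 1)) = \<Union>(edges P)"
proof -
  obtain k where k: "length P = Suc (Suc k)" "k > 0"
    using P by (auto simp: simple_polygon_def intro!: that[of "length P - 2"])
  have "edge P i \<inter> edge P (Suc k) \<subseteq> {vertex P 0, vertex P (Suc k)}" if "i \<le> k" for i
    using that k vertex_inj[OF P] vertex_length[of P]
    by (subst edge_Int_edge[OF P]) auto
  then have int: "path_image (chain P k) \<inter> edge P (Suc k) \<subseteq> {vertex P 0, vertex P (Suc k)}"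
    unfolding path_image_chain by blast
  have "simple_path (chain P k +++ linepath (vertex P (Suc k)) (vertex P (Suc (Suc k))))"
    using int k vertex_inj[OF P, of "Suc k" 0] vertex_length[of P]
    by (intro simple_path_join_loop arc_chain[OF P]) (auto simp: edge_def)
  then show "simple_path (chain P (length P - 1))" using k by simp
  show "pathfinish (chain P (length P - 1)) = pathstart (chain P (length P - 1))"
    using k vertex_length[of P] by simp
  show "path_image (chain P (length P - 1)) = \<Union>(edges P)"
    unfolding k path_image_chain edges_def by (simp only: lessThan_Suc_atMost diff_Suc_1)
qed

text \<open>The edges form a homeomorphic image of the circle, so by the Jordan-Brouwer theorem every
  component of the complement has all of them as its frontier. One such component is contained in
  the region.\<close>

lemma edges_in_frontier_region:
  assumes P: "simple_polygon P" and ne: "region P \<noteq> {}"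
  shows "\<Union>(edges P) \<subseteq> closure (region P)" "\<Union>(edges P) \<inter> region P = {}"
proof -
  let ?S = "\<Union>(edges P)"
  have "0 < (1::real)" by simp
  note homeomorphic_simple_path_image_circle[OF simple_path_chain(1,2)[OF P] this, of 0]
  then have "?S homeomorphic sphere (0::complex) 1"
    unfolding simple_path_chain(3)[OF P] .
  moreover have "sphere (0::complex) 1 homeomorphic sphere (0::real^2) 1"
    by (rule homeomorphic_spheres') auto
  ultimately have hom: "?S homeomorphic sphere (0::real^2) 1"
    by (rule homeomorphic_trans)
  obtain x where x: "x \<in> inside ?S" using ne by (auto simp: region_def)
  let ?T = "connected_component_set (- ?S) x"
  have xS: "x \<notin> ?S" using x inside_no_overlap by blast
  then have "?T \<in> components (- ?S)" by (intro componentsI) simp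
  with hom have "frontier ?T = ?S"
    by (rule Jordan_Brouwer_frontier) simp
  moreover have "?T \<subseteq> inside ?S"
  proof
    fix y assume "y \<in> ?T"
    then show "y \<in> inside ?S" using inside_same_component x by blast
  qed
  then have "closure ?T \<subseteq> closure (region P)"
    unfolding region_def by (rule closure_mono)
  ultimately show "?S \<subseteq> closure (region P)"
    by (simp only: frontier_def) blast
  show "?S \<inter> region P = {}"
    unfolding region_def using inside_no_overlap[of ?S] by (simp only: Int_commute)
qed

lemma compact_edges: "compact (\<Union>(edges P))"
  unfolding edges_def edge_def by (intro compact_Union) auto

lemma open_region: "open (region P)"
  unfolding region_def by (intro open_inside compact_imp_closed compact_edges)

lemma bounded_region: "bounded (region P)"
  unfolding region_def by (intro bounded_inside compact_imp_bounded compact_edges)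

lemma vertex_mod: "vertex P i = vertex P (i mod length P)"
  by (simp add: vertex_def)

lemma region_subset_convex:
  assumes "convex C" "0 < length P" "\<And>i. i < length P \<Longrightarrow> vertex P i \<in> C"
  shows "region P \<subseteq> C"
proof -
  have "vertex P i \<in> C" for i
    using assms(2,3) by (subst vertex_mod) simp
  then have "\<Union>(edges P) \<subseteq> C"
    unfolding edges_def edge_def using closed_segment_subset[OF _ _ assms(1)] by blast
  then show ?thesis
    unfolding region_def using outside_mono[of "\<Union>(edges P)" C] outside_convex[OF assms(1)]
    by (auto simp: inside_outside)
qed

text \<open>Approximate \<open>x\<close> by a point \<open>x'\<close> of \<open>S\<close> and move \<open>y\<close> to the point \<open>y'\<close> for which
  \<open>x' + t (y' - x')\<close> is the given point. As the ball is open, \<open>y'\<close> still lies in it.\<close>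

lemma star_shaped_closure:
  fixes S :: "'a::real_normed_vector set"
  assumes star: "\<And>x y. y \<in> ball c r \<Longrightarrow> x \<in> S \<Longrightarrow> closed_segment y x \<subseteq> S"
    and x: "x \<in> closure S" and y: "y \<in> ball c r" and t: "0 < t" "t \<le> 1"
  shows "x + t *\<^sub>R (y - x) \<in> S"
proof -
  define \<delta> where "\<delta> = (r - dist c y) * t"
  have "\<delta> > 0" using y t by (simp add: \<delta>_def)
  with x obtain x' where x': "x' \<in> S" "dist x' x < \<delta>"
    by (meson closure_approachable)
  define y' where "y' = y + ((1 - t) / t) *\<^sub>R (x - x')"
  have "dist y y' \<le> dist x' x / t"
    using t by (simp add: y'_def dist_norm norm_minus_commute divide_right_mono mult_left_le_one_le)
  also have "\<dots> < r - dist c y"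
    using x' t by (simp add: \<delta>_def field_simps)
  finally have "y' \<in> ball c r"
    using dist_triangle[of c y' y] by (simp add: dist_commute)
  have "(1 - t) *\<^sub>R x' + t *\<^sub>R y' \<in> closed_segment x' y'"
    unfolding in_segment using t by (intro exI[of _ t]) simp
  with star[OF \<open>y' \<in> ball c r\<close> x'(1)] have "(1 - t) *\<^sub>R x' + t *\<^sub>R y' \<in> S"
    by (auto simp: closed_segment_commute)
  moreover have "t *\<^sub>R y' = t *\<^sub>R y + (1 - t) *\<^sub>R (x - x')"
    using t by (simp add: y'_def scaleR_add_right)
  ultimately show ?thesis by (simp add: algebra_simps)
qed

text \<open>A single element of a mesh with (M1) and (M2), with its ball and its diameter \<open>h\<close>.\<close>

locale star_polygon =
  fixes E :: polygon and c :: "real^2" and r \<rho> h :: real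
  assumes simple: "simple_polygon E"
    and h_def: "h = diameter (region E)"
    and rho_pos: "\<rho> > 0" and r_gt: "\<rho> * h < r"
    and ball_sub: "ball c r \<subseteq> region E"
    and star: "\<And>x y. y \<in> ball c r \<Longrightarrow> x \<in> region E \<Longrightarrow> closed_segment y x \<subseteq> region E"
    and edge_length: "\<And>i. i < length E \<Longrightarrow> \<rho> * h \<le> dist (vertex E i) (vertex E (Suc i))"
begin

lemma length_ge_3: "length E \<ge> 3" using simple by (simp add: simple_polygon_def)

lemma h_nonneg: "h \<ge> 0" by (simp add: h_def diameter_ge_0 bounded_region)

lemma r_pos: "r > 0"
  using rho_pos r_gt h_nonneg by (smt (verit) mult_nonneg_nonneg)

lemma c_in: "c \<in> region E" using ball_sub r_pos by auto

lemma dist_le_h: "x \<in> closure (region E) \<Longrightarrow> y \<in> closure (region E) \<Longrightarrow> dist x y \<le> h"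
  using diameter_bounded_bound[of "closure (region E)"] bounded_region
  by (simp add: h_def diameter_closure bounded_closure)

lemma r_le_h: "r \<le> h"
proof -
  have "diameter (ball c r) \<le> h"
    unfolding h_def by (intro diameter_subset ball_sub bounded_region)
  then show ?thesis using r_pos by (simp add: diameter_ball)
qed

lemma h_pos: "h > 0" using r_le_h r_pos by simp

lemma region_subset_cball: "region E \<subseteq> cball c h"
proof
  fix x assume "x \<in> region E"
  then have "c \<in> closure (region E)" "x \<in> closure (region E)" using c_in closure_subset by blast+
  then show "x \<in> cball c h" using dist_le_h by simp
qed

lemma star_closure:
  "x \<in> closure (region E) \<Longrightarrow> y \<in> ball c r \<Longrightarrow> 0 < t \<Longrightarrow> t \<le> 1 \<Longrightarrow> x + t *\<^sub>R (y - x) \<in> region E"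
  by (rule star_shaped_closure[where c = c and r = r]) (use star in blast)+

lemma region_ne: "region E \<noteq> {}" using c_in by auto

lemma edge_closure: "i < length E \<Longrightarrow> x \<in> edge E i \<Longrightarrow> x \<in> closure (region E)"
  using edges_in_frontier_region(1)[OF simple region_ne] by (auto simp: edges_def)

lemma edge_notin: "i < length E \<Longrightarrow> x \<in> edge E i \<Longrightarrow> x \<notin> region E"
  using edges_in_frontier_region(2)[OF simple region_ne] by (auto simp: edges_def)

text \<open>A point of the ball on the edge itself would be an interior point of the element. For a point
  of the ball beyond one endpoint of the edge, that endpoint would lie on the segment from the other
  endpoint to the ball, hence in the open region.\<close>

lemma line_misses_ball:
  assumes i: "i < length E"
  shows "vertex E i + s *\<^sub>R (vertex E (Suc i) - vertex E i) \<notin> ball c r"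
proof
  define a b where "a = vertex E i" and "b = vertex E (Suc i)"
  define y where "y = a + s *\<^sub>R (b - a)"
  assume "vertex E i + s *\<^sub>R (vertex E (Suc i) - vertex E i) \<in> ball c r"
  then have y: "y \<in> ball c r" by (simp add: y_def a_def b_def)
  have ab: "a \<in> edge E i" "b \<in> edge E i" by (auto simp: a_def b_def edge_def)
  consider "0 \<le> s" "s \<le> 1" | "s > 1" | "s < 0" by linarith
  then show False
  proof cases
    case 1
    then have "y \<in> edge E i"
      unfolding edge_def in_segment
      by (intro exI[of _ s]) (simp add: y_def a_def b_def algebra_simps)
    then show False using edge_notin[OF i] y ball_sub by blast
  next
    case 2
    have "a + (1 / s) *\<^sub>R (y - a) \<in> region E"
      using star_closure[OF edge_closure[OF i ab(1)] y, of "1 / s"] 2 by simp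
    then show False using edge_notin[OF i ab(2)] 2 by (simp add: y_def)
  next
    case 3
    have "b + (1 / (1 - s)) *\<^sub>R (y - b) \<in> region E"
      using star_closure[OF edge_closure[OF i ab(2)] y, of "1 / (1 - s)"] 3 by simp
    moreover have "y - b = (1 - s) *\<^sub>R (a - b)" by (simp add: y_def algebra_simps)
    ultimately show False using edge_notin[OF i ab(1)] 3 by simp
  qed
qed

definition sector :: "nat \<Rightarrow> (real^2) set" where
  "sector i = convex hull {c, vertex E i, vertex E (Suc i)}"

text \<open>The area is half the length of the edge times the distance of \<open>c\<close> from the line through it.
  This distance is at least \<open>r\<close> because the line misses the ball.\<close>

lemma sector_area:
  assumes i: "i < length E"
  shows "measure lebesgue (sector i) \<ge> \<rho>\<^sup>2 * h\<^sup>2 / 2"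
proof -
  define a b where "a = vertex E i" and "b = vertex E (Suc i)"
  define d w where "d = b - a" and "w = a - c"
  define D where "D = d $ 1 * w $ 2 - d $ 2 * w $ 1"
  have len: "norm d \<ge> \<rho> * h"
    using edge_length[OF i] by (simp add: a_def b_def d_def dist_norm norm_minus_commute)
  have pos: "0 < \<rho> * h" using rho_pos h_pos by simp
  then have dpos: "norm d > 0" using len by linarith
  \<comment> \<open>The parameter of the foot of the perpendicular from \<open>c\<close> to the line.\<close>
  define s where "s = - (w \<bullet> d) / (norm d)\<^sup>2"
  have "a + s *\<^sub>R d \<notin> ball c r"
    using line_misses_ball[OF i] by (simp add: a_def b_def d_def)
  then have "r \<le> norm (w + s *\<^sub>R d)"
    by (simp add: dist_norm w_def norm_minus_commute algebra_simps)
  then have "r * norm d \<le> norm (w + s *\<^sub>R d) * norm d" using dpos by simp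
  also have "(norm (w + s *\<^sub>R d) * norm d)\<^sup>2 = D\<^sup>2"
  proof -
    have "(norm (w + s *\<^sub>R d))\<^sup>2 * (norm d)\<^sup>2 = (norm w)\<^sup>2 * (norm d)\<^sup>2 - (w \<bullet> d)\<^sup>2"
    proof -
      have "(norm (w + s *\<^sub>R d))\<^sup>2 = (norm w)\<^sup>2 + 2 * s * (w \<bullet> d) + s\<^sup>2 * (norm d)\<^sup>2"
        unfolding power2_norm_eq_inner
        by (simp add: inner_add_left inner_add_right inner_commute power2_eq_square)
      then show ?thesis
        using dpos by (simp add: s_def field_simps power2_eq_square)
    qed
    also have "\<dots> = D\<^sup>2"
      unfolding power2_norm_eq_inner inner_vec_def D_def by (simp add: sum_2) algebra
    finally show ?thesis by (simp add: power_mult_distrib)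
  qed
  then have "norm (w + s *\<^sub>R d) * norm d = \<bar>D\<bar>"
    using power2_eq_iff_nonneg[of "norm (w + s *\<^sub>R d) * norm d" "\<bar>D\<bar>"] by (simp only: power2_abs) simp
  finally have "r * norm d \<le> \<bar>D\<bar>" .
  moreover have "(\<rho> * h) * (\<rho> * h) \<le> r * norm d"
    using len r_gt pos by (intro mult_mono) auto
  moreover have "measure lebesgue (sector i) = \<bar>D\<bar> / 2"
  proof -
    have "measure lebesgue (sector i) = measure lborel (convex hull {c, a, b})"
      unfolding sector_def a_def b_def
      by (intro measure_completion)
         (simp add: borel_closed compact_imp_closed finite_imp_compact_convex_hull)
    moreover have "(b $ 1 - c $ 1) * (a $ 2 - c $ 2) - (a $ 1 - c $ 1) * (b $ 2 - c $ 2) = D"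
      unfolding D_def d_def w_def vector_minus_component by algebra
    ultimately show ?thesis
      by (simp only: content_triangle)
  qed
  ultimately show ?thesis by (simp add: power2_eq_square algebra_simps)
qed

text \<open>A common point other than \<open>c\<close> determines a ray from \<open>c\<close>. Two different frontier points on that
  ray are impossible, because the nearer one would belong to the region. So the ray ends in a common
  point of the two edges, that is, in a vertex.\<close>

lemma sector_Int_negligible:
  assumes i: "i < length E" and j: "j < length E" and "i \<noteq> j"
  shows "negligible (sector i \<inter> sector j)"
proof -
  let ?N = "closed_segment c (vertex E i) \<union> closed_segment c (vertex E (Suc i))"
  have cone: "\<exists>x t. x \<in> edge E k \<and> 0 \<le> t \<and> t \<le> 1 \<and> z = c + t *\<^sub>R (x - c)" if "z \<in> sector k" for z k
  proof -
    have "sector k = {z. \<exists>u\<ge>0. \<exists>v\<ge>0. \<exists>x. u + v = 1 \<and> x \<in> edge E k \<and> z = u *\<^sub>R c + v *\<^sub>R x}"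
      unfolding sector_def edge_def segment_convex_hull by (rule convex_hull_insert) simp
    with that obtain u v x where "0 \<le> u" "0 \<le> v" "u + v = 1" "x \<in> edge E k" "z = u *\<^sub>R c + v *\<^sub>R x"
      by blast
    moreover from this have "z = c + v *\<^sub>R (x - c)"
      by (simp add: algebra_simps flip: scaleR_add_left)
    ultimately show ?thesis by (intro exI[of _ x] exI[of _ v]) auto
  qed
  have le: "t' \<le> t" if "x \<in> edge E k" "x' \<in> edge E k'" "k < length E" "k' < length E"
     "t *\<^sub>R (x - c) = t' *\<^sub>R (x' - c)" "0 \<le> t" "0 < t'" for x x' t t' k k'
  proof (rule ccontr)
    assume "\<not> t' \<le> t"
    then have lt: "t < t'" by simp
    have "x' - c = (1 / t') *\<^sub>R t' *\<^sub>R (x' - c)" using that by simp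
    also have "\<dots> = (t / t') *\<^sub>R (x - c)" by (simp flip: that(5))
    finally have "x' - c = (t / t') *\<^sub>R (x - c)" .
    then have "x' = x + (1 - t / t') *\<^sub>R (c - x)" by (simp add: algebra_simps)
    moreover have "x + (1 - t / t') *\<^sub>R (c - x) \<in> region E"
      using that lt r_pos by (intro star_closure edge_closure) auto
    ultimately show False using edge_notin that by blast
  qed
  have "sector i \<inter> sector j \<subseteq> ?N"
  proof
    fix z assume z: "z \<in> sector i \<inter> sector j"
    obtain x t where x: "x \<in> edge E i" "0 \<le> t" "t \<le> 1" "z = c + t *\<^sub>R (x - c)" using cone z by blast
    obtain x' t' where x': "x' \<in> edge E j" "0 \<le> t'" "t' \<le> 1" "z = c + t' *\<^sub>R (x' - c)" using cone z by blast
    show "z \<in> ?N"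
    proof (cases "z = c")
      case False
      then have pos: "t > 0" "t' > 0" using x x' by (auto simp: less_eq_real_def)
      have "t = t'"
        using le[of x i x' j t t'] le[of x' j x i t' t] pos x x' i j by force
      then have "x = x'" using x x' pos by simp
      then have "x \<in> edge E i \<inter> edge E j" using x x' by blast
      then have "x = vertex E i \<or> x = vertex E (Suc i)"
        using edge_Int_edge[OF simple i j \<open>i \<noteq> j\<close>] by blast
      moreover have "z \<in> closed_segment c x"
        using x unfolding in_segment by (intro exI[of _ t]) (simp add: algebra_simps)
      ultimately show ?thesis by blast
    qed auto
  qed
  moreover have "negligible (closed_segment c y)" for y :: "real^2"
    by (simp add: negligible_convex_interior interior_closed_segment_ge2)
  ultimately show ?thesis
    by (meson negligible_Un negligible_subset)
qed

lemma sector_subset_cball: assumes i: "i < length E" shows "sector i \<subseteq> cball c h"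
proof -
  have "vertex E i \<in> closure (region E)" "vertex E (Suc i) \<in> closure (region E)"
    by (rule edge_closure[OF i]; simp add: edge_def)+
  then show ?thesis
    unfolding sector_def using dist_le_h c_in closure_subset h_nonneg
    by (intro hull_minimal) (auto simp: subset_iff)
qed

lemma number_of_edges: "length E \<le> 2 * pi / \<rho>\<^sup>2"
proof -
  have meas: "sector i \<in> lmeasurable" for i
    unfolding sector_def by (intro lmeasurable_compact finite_imp_compact_convex_hull) auto
  have "length E * (\<rho>\<^sup>2 * h\<^sup>2 / 2) \<le> (\<Sum>i<length E. measure lebesgue (sector i))"
    using sum_mono[OF sector_area, of "{..<length E}"] by simp
  also have "\<dots> = measure lebesgue (\<Union>i<length E. sector i)"
    using sector_Int_negligible meas
    by (intro measure_negligible_finite_Union_image[symmetric]) (auto simp: pairwise_def)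
  also have "\<dots> \<le> measure lebesgue (cball c h)"
    using sector_subset_cball meas by (intro measure_mono_fmeasurable) (auto simp: fmeasurableD)
  also have "\<dots> = pi * h\<^sup>2"
    using h_nonneg by (simp add: content_cball measure_completion unit_ball_vol_2)
  finally show ?thesis
    using rho_pos h_pos by (simp add: field_simps)
qed

end

section \<open>Averaged differences of functions with a weak gradient\<close>

context star_polygon
begin

abbreviation "S \<equiv> region E"

text \<open>An extended real, so that no integrability has to be established in the chains of estimates.\<close>

definition energy :: "(real^2 \<Rightarrow> real^2) \<Rightarrow> ennreal" where
  "energy g = (\<integral>\<^sup>+y. ennreal (indicator S y * (norm (g y))\<^sup>2) \<partial>lebesgue)"

text \<open>Contraction by the factor \<open>\<kappa> = 1 - \<theta>\<close> towards \<open>c\<close> moves the closure of the element to distance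
  at least \<open>\<theta> r\<close> from the complement, since the image of \<open>x\<close> is \<open>x + \<theta> (c - x)\<close> and \<open>c\<close> may be
  replaced by any point of the ball. Mollification at a scale \<open>\<epsilon>\<close> below \<open>\<theta> r\<close> is then possible. Uniform
  continuity makes both changes small.\<close>

lemma smooth_approximation:
  assumes cont: "continuous_on UNIV V" and weak: "L2_weak_gradient S V g" and eta: "\<eta> > 0"
  obtains w \<gamma> where
    "\<And>p d s. ((\<lambda>s. w (p + s *\<^sub>R d)) has_field_derivative (\<gamma> (p + s *\<^sub>R d) \<bullet> d)) (at s)"
    "continuous_on UNIV w" "continuous_on UNIV \<gamma>"
    "\<And>x. x \<in> closure S \<Longrightarrow> \<bar>w x - V x\<bar> \<le> \<eta>"
    "(\<integral>\<^sup>+x. indicator S x * ennreal ((norm (\<gamma> x))\<^sup>2) \<partial>lborel) \<le> energy g"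
proof -
  have "uniformly_continuous_on (closure S) V"
    using bounded_region by (intro compact_uniformly_continuous continuous_on_subset[OF cont]) auto
  then obtain \<delta> where "\<delta> > 0" and
    unif: "\<And>x x'. x \<in> closure S \<Longrightarrow> x' \<in> closure S \<Longrightarrow> dist x' x < \<delta> \<Longrightarrow> dist (V x') (V x) < \<eta> / 2"
    using eta unfolding uniformly_continuous_on_def by (metis half_gt_zero)
  define \<theta> where "\<theta> = min (1 / 2) (\<delta> / (2 * h))"
  define \<epsilon> where "\<epsilon> = min (\<delta> / 2) (\<theta> * r / 2)"
  have \<theta>: "0 < \<theta>" "\<theta> < 1" "\<theta> * h < \<delta>"
    using \<open>\<delta> > 0\<close> h_pos by (auto simp: \<theta>_def min_def field_simps)
  have \<epsilon>: "0 < \<epsilon>" "\<epsilon> < \<delta>" "\<epsilon> < \<theta> * r"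
    using \<open>\<delta> > 0\<close> \<theta> r_pos by (auto simp: \<epsilon>_def min_def)
  obtain b where b: "S \<subseteq> cbox (- b) b"
    using bounded_region bounded_subset_cbox_symmetric by blast
  interpret mollification S "- b" b V g \<epsilon>
    by standard (use open_region b cont weak \<epsilon> in auto)
  define q where "q = \<theta> *\<^sub>R c"
  define \<kappa> where "\<kappa> = 1 - \<theta>"
  have kap: "0 < \<kappa>" using \<theta> by (simp add: \<kappa>_def)
  have inside: "cball (q + \<kappa> *\<^sub>R x) \<epsilon> \<subseteq> S" if x: "x \<in> closure S" for x
  proof
    fix z assume "z \<in> cball (q + \<kappa> *\<^sub>R x) \<epsilon>"
    then have z: "norm (q + \<kappa> *\<^sub>R x - z) \<le> \<epsilon>" by (simp add: dist_norm)
    define y where "y = x + (1 / \<theta>) *\<^sub>R (z - x)"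
    have "c - y = (1 / \<theta>) *\<^sub>R (q + \<kappa> *\<^sub>R x - z)"
      using \<theta> by (simp add: y_def q_def \<kappa>_def algebra_simps)
    then have "dist c y = norm (q + \<kappa> *\<^sub>R x - z) / \<theta>"
      using \<theta> by (simp add: dist_norm)
    also have "\<dots> < r" using z \<epsilon> \<theta> by (simp add: field_simps)
    finally have "x + \<theta> *\<^sub>R (y - x) \<in> S" using x \<theta> by (intro star_closure) auto
    then show "z \<in> S" using \<theta> by (simp add: y_def)
  qed
  show ?thesis
  proof
    show "((\<lambda>s. smoothed (q + \<kappa> *\<^sub>R (p + s *\<^sub>R d))) has_field_derivative
        ((\<kappa> *\<^sub>R smoothed_grad (q + \<kappa> *\<^sub>R (p + s *\<^sub>R d))) \<bullet> d)) (at s)" for p d s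
      using smoothed_derivative[of "q + \<kappa> *\<^sub>R p" "\<kappa> *\<^sub>R d" s]
      by (simp add: algebra_simps)
    show "continuous_on UNIV (\<lambda>x. smoothed (q + \<kappa> *\<^sub>R x))"
      by (intro continuous_on_compose2[OF continuous_smoothed] continuous_intros) auto
    show "continuous_on UNIV (\<lambda>x. \<kappa> *\<^sub>R smoothed_grad (q + \<kappa> *\<^sub>R x))"
      by (intro continuous_on_scaleR continuous_on_const
          continuous_on_compose2[OF continuous_smoothed_grad] continuous_intros) auto
    show "(\<integral>\<^sup>+x. indicator S x * ennreal ((norm (\<kappa> *\<^sub>R smoothed_grad (q + \<kappa> *\<^sub>R x)))\<^sup>2) \<partial>lborel) \<le> energy g"
      unfolding energy_def using inside closure_subset[of S] open_region
      by (intro smoothed_grad_contracted_le kap) auto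
    show "\<bar>smoothed (q + \<kappa> *\<^sub>R x) - V x\<bar> \<le> \<eta>" if x: "x \<in> closure S" for x
    proof -
      let ?p = "q + \<kappa> *\<^sub>R x"
      have p: "?p \<in> closure S" using inside[OF x] \<epsilon> closure_subset by force
      have "\<bar>smoothed ?p - V ?p\<bar> \<le> \<eta> / 2"
      proof (rule smoothed_approx)
        show "cball ?p \<epsilon> \<subseteq> cbox (- b) b" using inside[OF x] b by blast
        fix y assume y: "y \<in> cball ?p \<epsilon>"
        then have "y \<in> closure S" using inside[OF x] closure_subset[of S] by blast
        moreover have "dist y ?p < \<delta>" using y \<epsilon> by (simp add: dist_commute)
        ultimately show "\<bar>V y - V ?p\<bar> \<le> \<eta> / 2" using unif[OF p] by (fastforce simp: dist_real_def)
      qed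
      moreover have "?p - x = \<theta> *\<^sub>R (c - x)" by (simp add: q_def \<kappa>_def algebra_simps)
      then have "dist ?p x \<le> \<theta> * h"
        using dist_le_h[of c x] x c_in closure_subset \<theta> by (auto simp: dist_norm intro!: mult_left_mono)
      then have "dist (V ?p) (V x) < \<eta> / 2" using \<theta> by (intro unif x p) auto
      ultimately show ?thesis unfolding dist_real_def by linarith
    qed
  qed
qed

lemma emeasure_ball_le: "emeasure lborel (ball c r) \<le> ennreal (4 * h\<^sup>2)"
proof -
  have "pi * r\<^sup>2 \<le> 4 * h\<^sup>2"
    using r_pos r_le_h pi_less_4 by (intro mult_mono power_mono) auto
  then show ?thesis
    using r_pos by (auto simp: emeasure_ball unit_ball_vol_2 intro!: ennreal_leI)
qed

text \<open>Apply the estimate for differentiable functions to an approximation with error \<open>\<eta>\<close>. From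
  \<open>(\<alpha> + \<beta>)\<^sup>2 \<le> 2 \<alpha>\<^sup>2 + 2 \<beta>\<^sup>2\<close> one pays a factor 2 and an additional term of order \<open>\<eta>\<^sup>2\<close>, which is
  arbitrarily small.\<close>

lemma averaged_difference_estimate:
  assumes cont: "continuous_on UNIV V" and weak: "L2_weak_gradient S V g"
    and sets [measurable_cong]: "sets \<mu> = sets borel" and sf: "sigma_finite_measure \<mu>"
    and supp: "AE x in \<mu>. x \<in> closure S"
    and growth: "\<And>p R. R > 0 \<Longrightarrow> emeasure \<mu> (cball p R) \<le> ennreal (A * R)"
    and total: "emeasure \<mu> UNIV \<le> ennreal (A * h)"
    and A: "A \<ge> 0"
  shows "(\<integral>\<^sup>+x. \<integral>\<^sup>+y. indicator (ball c r) y * ennreal ((V x - V y)\<^sup>2) \<partial>lborel \<partial>\<mu>)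
    \<le> ennreal (16 * A * h ^ 3) * energy g"
proof (rule ennreal_le_epsilon)
  interpret sigma_finite_measure \<mu> by fact
  fix e :: real assume "e > 0"
  define B where "B = ball c r"
  have B [measurable]: "B \<in> sets borel" by (simp add: B_def)
  have B_sub: "B \<subseteq> cball c r" "B \<subseteq> closure S" using ball_sub closure_subset by (auto simp: B_def)
  define T where "T = 4 * h\<^sup>2 * (A * h)"
  have T: "T \<ge> 0" using A h_nonneg by (simp add: T_def)
  define \<eta> where "\<eta> = sqrt (e / (8 * (T + 1)))"
  have \<eta>: "\<eta> > 0" "8 * \<eta>\<^sup>2 * T \<le> e"
    using \<open>e > 0\<close> T by (auto simp: \<eta>_def field_simps)
  obtain w \<gamma> where deriv: "\<And>p d s. ((\<lambda>s. w (p + s *\<^sub>R d)) has_field_derivative (\<gamma> (p + s *\<^sub>R d) \<bullet> d)) (at s)"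
    and cw: "continuous_on UNIV w" and cg: "continuous_on UNIV \<gamma>"
    and approx: "\<And>x. x \<in> closure S \<Longrightarrow> \<bar>w x - V x\<bar> \<le> \<eta>"
    and energy: "(\<integral>\<^sup>+x. indicator S x * ennreal ((norm (\<gamma> x))\<^sup>2) \<partial>lborel) \<le> energy g"
    by (rule smooth_approximation[OF cont weak \<eta>(1)]) (rule that)
  have [measurable]: "w \<in> borel_measurable borel" using cw by (rule borel_measurable_continuous_onI)
  let ?W = "\<lambda>x y. indicator B y * ennreal ((w x - w y)\<^sup>2)"
  have "(\<integral>\<^sup>+x. \<integral>\<^sup>+y. indicator B y * ennreal ((V x - V y)\<^sup>2) \<partial>lborel \<partial>\<mu>)
     \<le> (\<integral>\<^sup>+x. \<integral>\<^sup>+y. 2 * ?W x y + ennreal (8 * \<eta>\<^sup>2) * indicator B y \<partial>lborel \<partial>\<mu>)"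
  proof (rule nn_integral_mono_AE, use supp in eventually_elim, rule nn_integral_mono)
    fix x y assume x: "x \<in> closure S"
    show "indicator B y * ennreal ((V x - V y)\<^sup>2) \<le> 2 * ?W x y + ennreal (8 * \<eta>\<^sup>2) * indicator B y"
    proof (cases "y \<in> B")
      case True
      define \<alpha> \<beta> where "\<alpha> = w x - w y" and "\<beta> = (V x - V y) - \<alpha>"
      have "\<bar>\<beta>\<bar> \<le> 2 * \<eta>" using approx[OF x] approx[of y] True B_sub by (auto simp: \<alpha>_def \<beta>_def)
      then have "\<beta>\<^sup>2 \<le> (2 * \<eta>)\<^sup>2" using power_mono[of "\<bar>\<beta>\<bar>" "2 * \<eta>" 2] by simp
      moreover have "(V x - V y)\<^sup>2 \<le> 2 * \<alpha>\<^sup>2 + 2 * \<beta>\<^sup>2"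
      proof -
        have "(\<alpha> + \<beta>)\<^sup>2 + (\<alpha> - \<beta>)\<^sup>2 = 2 * \<alpha>\<^sup>2 + 2 * \<beta>\<^sup>2"
          by (simp add: power2_eq_square algebra_simps)
        moreover have "V x - V y = \<alpha> + \<beta>" by (simp add: \<beta>_def)
        ultimately show ?thesis
          using zero_le_power2[of "\<alpha> - \<beta>"] unfolding \<open>V x - V y = \<alpha> + \<beta>\<close> by linarith
      qed
      ultimately have "(V x - V y)\<^sup>2 \<le> 2 * (w x - w y)\<^sup>2 + 8 * \<eta>\<^sup>2" by (simp add: \<alpha>_def power_mult_distrib)
      then have "ennreal ((V x - V y)\<^sup>2) \<le> ennreal (2 * (w x - w y)\<^sup>2 + 8 * \<eta>\<^sup>2)" by (rule ennreal_leI)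
      also have "\<dots> = 2 * ennreal ((w x - w y)\<^sup>2) + ennreal (8 * \<eta>\<^sup>2)"
        by (simp add: ennreal_plus ennreal_mult)
      finally show ?thesis using True by simp
    qed simp
  qed
  also have "\<dots> = (\<integral>\<^sup>+x. 2 * (\<integral>\<^sup>+y. ?W x y \<partial>lborel) + ennreal (8 * \<eta>\<^sup>2) * emeasure lborel B \<partial>\<mu>)"
  proof (rule nn_integral_cong)
    fix x
    have "(\<integral>\<^sup>+y. 2 * ?W x y + ennreal (8 * \<eta>\<^sup>2) * indicator B y \<partial>lborel)
       = (\<integral>\<^sup>+y. 2 * ?W x y \<partial>lborel) + (\<integral>\<^sup>+y. ennreal (8 * \<eta>\<^sup>2) * indicator B y \<partial>lborel)"
      by (intro nn_integral_add) measurable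
    also have "(\<integral>\<^sup>+y. 2 * ?W x y \<partial>lborel) = 2 * (\<integral>\<^sup>+y. ?W x y \<partial>lborel)"
      by (intro nn_integral_cmult) measurable
    also have "(\<integral>\<^sup>+y. ennreal (8 * \<eta>\<^sup>2) * indicator B y \<partial>lborel) = ennreal (8 * \<eta>\<^sup>2) * emeasure lborel B"
      by (rule nn_integral_cmult_indicator) simp
    finally show "(\<integral>\<^sup>+y. 2 * ?W x y + ennreal (8 * \<eta>\<^sup>2) * indicator B y \<partial>lborel)
       = 2 * (\<integral>\<^sup>+y. ?W x y \<partial>lborel) + ennreal (8 * \<eta>\<^sup>2) * emeasure lborel B" .
  qed
  also have "\<dots> = (\<integral>\<^sup>+x. 2 * (\<integral>\<^sup>+y. ?W x y \<partial>lborel) \<partial>\<mu>) + (\<integral>\<^sup>+x. ennreal (8 * \<eta>\<^sup>2) * emeasure lborel B \<partial>\<mu>)"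
    by (intro nn_integral_add) measurable
  also have "(\<integral>\<^sup>+x. 2 * (\<integral>\<^sup>+y. ?W x y \<partial>lborel) \<partial>\<mu>) = 2 * (\<integral>\<^sup>+x. \<integral>\<^sup>+y. ?W x y \<partial>lborel \<partial>\<mu>)"
    by (intro nn_integral_cmult) measurable
  also have "2 * (\<integral>\<^sup>+x. \<integral>\<^sup>+y. ?W x y \<partial>lborel \<partial>\<mu>) \<le> 2 * (ennreal (8 * A * h ^ 3) * energy g)"
  proof (rule mult_left_mono)
    have "(\<integral>\<^sup>+x. \<integral>\<^sup>+y. ?W x y \<partial>lborel \<partial>\<mu>)
       \<le> ennreal (8 * A * h ^ 3) * (\<integral>\<^sup>+z. indicator S z * ennreal ((norm (\<gamma> z))\<^sup>2) \<partial>lborel)"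
      using B_sub dist_le_h star_closure
      by (intro potential_estimate[OF deriv cg sets sf supp growth total A r_pos r_le_h B B_sub(1) open_region])
         (auto simp: B_def)
    also have "\<dots> \<le> ennreal (8 * A * h ^ 3) * energy g"
      by (intro mult_left_mono energy) simp
    finally show "(\<integral>\<^sup>+x. \<integral>\<^sup>+y. ?W x y \<partial>lborel \<partial>\<mu>) \<le> ennreal (8 * A * h ^ 3) * energy g" .
  qed simp
  also have "2 * (ennreal (8 * A * h ^ 3) * energy g) = (2 * ennreal (8 * A * h ^ 3)) * energy g"
    by (simp only: mult.assoc)
  also have "2 * ennreal (8 * A * h ^ 3) = ennreal (16 * A * h ^ 3)"
    using A h_nonneg by (simp flip: ennreal_numeral ennreal_mult)
  also have "(\<integral>\<^sup>+x. ennreal (8 * \<eta>\<^sup>2) * emeasure lborel B \<partial>\<mu>) = ennreal (8 * \<eta>\<^sup>2) * (emeasure lborel B * emeasure \<mu> UNIV)"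
    using sets_eq_imp_space_eq[OF sets] by (simp add: mult.assoc)
  also have "\<dots> \<le> ennreal (8 * \<eta>\<^sup>2) * (ennreal (4 * h\<^sup>2) * ennreal (A * h))"
    unfolding B_def by (intro mult_left_mono mult_mono emeasure_ball_le total) auto
  also have "\<dots> = ennreal (8 * \<eta>\<^sup>2 * T)"
    using A h_nonneg unfolding T_def by (simp flip: ennreal_mult)
  also have "\<dots> \<le> ennreal e" by (intro ennreal_leI \<eta>)
  finally show "(\<integral>\<^sup>+x. \<integral>\<^sup>+y. indicator (ball c r) y * ennreal ((V x - V y)\<^sup>2) \<partial>lborel \<partial>\<mu>)
    \<le> ennreal (16 * A * h ^ 3) * energy g + ennreal e" by (simp add: B_def add_left_mono)
qed

end

section \<open>The projection determined by the vertex values\<close>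

lemma P1_memI: "(\<lambda>x. \<alpha> + \<beta> \<bullet> x) \<in> P1"
  by (auto simp: P1_def)

lemma P1_diff: "p \<in> P1 \<Longrightarrow> q \<in> P1 \<Longrightarrow> (\<lambda>x. p x - q x) \<in> P1"
proof -
  assume "p \<in> P1" "q \<in> P1"
  then obtain \<alpha> \<beta> \<alpha>' \<beta>' where "p = (\<lambda>x. \<alpha> + \<beta> \<bullet> x)" "q = (\<lambda>x. \<alpha>' + \<beta>' \<bullet> x)" by (auto simp: P1_def)
  then have "(\<lambda>x. p x - q x) = (\<lambda>x. (\<alpha> - \<alpha>') + (\<beta> - \<beta>') \<bullet> x)" by (auto simp: inner_diff_left)
  then show ?thesis by (simp only: P1_memI)
qed

lemma P1_const: "(\<lambda>x. \<alpha>) \<in> P1"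
  using P1_memI[of \<alpha> 0] by simp

lemma convex_P1_abs_le:
  assumes "p \<in> P1" shows "convex {x. \<bar>p x\<bar> \<le> M}"
proof -
  obtain \<alpha> \<beta> where p: "p = (\<lambda>x. \<alpha> + \<beta> \<bullet> x)" using assms by (auto simp: P1_def)
  have "{x. \<bar>p x\<bar> \<le> M} = {x. \<beta> \<bullet> x \<le> M - \<alpha>} \<inter> {x. \<beta> \<bullet> x \<ge> - M - \<alpha>}"
    by (auto simp: p abs_le_iff)
  then show ?thesis by (simp only: convex_Int convex_halfspace_le convex_halfspace_ge)
qed

context star_polygon
begin

lemma P1_bound_by_vertices:
  assumes p: "p \<in> P1" and M: "\<And>i. i < length E \<Longrightarrow> \<bar>p (vertex E i)\<bar> \<le> M" and x: "x \<in> region E"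
  shows "\<bar>p x\<bar> \<le> M"
proof -
  have "0 < length E" using length_ge_3 by linarith
  then have "region E \<subseteq> {x. \<bar>p x\<bar> \<le> M}"
    using M by (intro region_subset_convex convex_P1_abs_le[OF p]) simp_all
  then show ?thesis using x by blast
qed

text \<open>The function vanishes on the convex hull of the vertices, hence on the whole ball; an affine
  function that vanishes on a ball is zero.\<close>

lemma P1_zero:
  assumes p: "p \<in> P1" and 0: "\<And>i. i < length E \<Longrightarrow> p (vertex E i) = 0"
  shows "p = (\<lambda>x. 0)"
proof -
  obtain \<alpha> \<beta> where p': "p = (\<lambda>x. \<alpha> + \<beta> \<bullet> x)" using p by (auto simp: P1_def)
  have zero: "p x = 0" if "x \<in> region E" for x
    using P1_bound_by_vertices[OF p _ that, of 0] 0 by simp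
  define n where "n = norm \<beta> + 1"
  have n: "n > 0" "norm \<beta> \<le> n" by (simp_all add: n_def add_nonneg_pos)
  define t where "t = r / (2 * n)"
  have t: "t > 0" using r_pos n by (simp add: t_def)
  have "t * norm \<beta> < r"
  proof -
    have "t * norm \<beta> \<le> t * n" using t n by simp
    also have "\<dots> = r / 2" using n by (simp add: t_def)
    finally show ?thesis using r_pos by simp
  qed
  then have "c + t *\<^sub>R \<beta> \<in> region E"
    using ball_sub t by (auto simp: subset_iff dist_norm)
  from zero[OF this] zero[OF c_in] have "t * (\<beta> \<bullet> \<beta>) = 0"
    unfolding p' inner_add_right inner_scaleR_right by linarith
  then have "\<beta> = 0" using t by simp
  with zero[OF c_in] show ?thesis by (simp add: p')
qed

lemma area_pos: "measure lebesgue (region E) > 0"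
proof -
  have "\<not> negligible (region E)"
    using open_not_negligible[OF open_region region_ne] .
  then show ?thesis
    using bounded_region open_region
    by (metis lmeasurable_open measure_nonneg less_le negligible_iff_measure)
qed

text \<open>\<open>T\<close> is the operator of the normal equations in the coefficients of \<open>p\<close>. It is injective because
  \<open>T z \<bullet> z\<close> is the sum of squares of \<open>p\<close> at the vertices, hence it is surjective.\<close>

lemma least_squares_exists:
  "\<exists>p\<in>P1. \<forall>q\<in>P1. (\<Sum>i<length E. (v (vertex E i) - p (vertex E i)) * q (vertex E i)) = 0"
proof -
  let ?x = "vertex E" and ?I = "{..<length E}"
  define T :: "real \<times> (real^2) \<Rightarrow> real \<times> (real^2)" where
    "T z = (\<Sum>i\<in>?I. fst z + snd z \<bullet> ?x i, \<Sum>i\<in>?I. (fst z + snd z \<bullet> ?x i) *\<^sub>R ?x i)" for z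
  have pair': "(\<Sum>i\<in>?I. f i, \<Sum>i\<in>?I. f i *\<^sub>R ?x i) \<bullet> (\<alpha>, \<beta>) = (\<Sum>i\<in>?I. f i * (\<alpha> + \<beta> \<bullet> ?x i))" for f \<alpha> \<beta>
    by (simp add: inner_sum_right sum_distrib_left distrib_left sum.distrib inner_commute[of _ \<beta>] mult.commute)
  have pair: "T z \<bullet> (\<alpha>, \<beta>) = (\<Sum>i\<in>?I. (fst z + snd z \<bullet> ?x i) * (\<alpha> + \<beta> \<bullet> ?x i))" for z \<alpha> \<beta>
    unfolding T_def by (rule pair')
  have "linear T"
  proof (rule linearI)
    show "T (z + z') = T z + T z'" for z z'
      by (simp add: T_def inner_add_left sum.distrib scaleR_add_left algebra_simps)
    show "T (k *\<^sub>R z) = k *\<^sub>R T z" for k z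
      by (simp add: T_def scaleR_sum_right sum_distrib_left distrib_left)
  qed
  moreover have "inj T"
  proof (subst linear_inj_iff_eq_0[OF \<open>linear T\<close>], intro allI impI)
    fix z assume "T z = 0"
    then have "(\<Sum>i\<in>?I. (fst z + snd z \<bullet> ?x i)\<^sup>2) = 0"
      using pair[of z "fst z" "snd z"] by (simp add: power2_eq_square)
    then have "\<forall>i\<in>?I. fst z + snd z \<bullet> ?x i = 0"
      by (subst (asm) sum_nonneg_eq_0_iff) auto
    then have "(\<lambda>x. fst z + snd z \<bullet> x) = (\<lambda>x. 0)"
      by (intro P1_zero P1_memI) simp
    then have *: "fst z + snd z \<bullet> x = 0" for x by meson
    have "fst z = 0" using *[of 0] by simp
    moreover from this have "snd z = 0" using *[of "snd z"] by simp
    ultimately show "z = 0" by (simp add: prod_eq_iff)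
  qed
  ultimately have "surj T" using linear_injective_imp_surjective by blast
  then obtain z where z: "T z = (\<Sum>i\<in>?I. v (?x i), \<Sum>i\<in>?I. v (?x i) *\<^sub>R ?x i)" by (metis surjD)
  have "(\<Sum>i<length E. (v (?x i) - (fst z + snd z \<bullet> ?x i)) * q (?x i)) = 0" if q: "q \<in> P1" for q
  proof -
    obtain \<alpha> \<beta> where q': "q = (\<lambda>x. \<alpha> + \<beta> \<bullet> x)" using q by (auto simp: P1_def)
    have "(\<Sum>i\<in>?I. v (?x i) * (\<alpha> + \<beta> \<bullet> ?x i)) = (\<Sum>i\<in>?I. v (?x i), \<Sum>i\<in>?I. v (?x i) *\<^sub>R ?x i) \<bullet> (\<alpha>, \<beta>)"
      by (rule pair'[symmetric])
    also have "\<dots> = (\<Sum>i\<in>?I. (fst z + snd z \<bullet> ?x i) * (\<alpha> + \<beta> \<bullet> ?x i))"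
      by (simp add: pair flip: z)
    finally show ?thesis by (simp add: q' left_diff_distrib sum_subtractf)
  qed
  then show ?thesis by (intro bexI[of _ "\<lambda>x. fst z + snd z \<bullet> x"] P1_memI) auto
qed

lemma vertex_projection:
  shows "vertex_projection E v \<in> P1"
    and "q \<in> P1 \<Longrightarrow> (\<Sum>i<length E. (v (vertex E i) - vertex_projection E v (vertex E i)) * q (vertex E i)) = 0"
proof -
  let ?R = "\<lambda>p. p \<in> P1 \<and> (\<forall>q\<in>P1. vertex_product E (\<lambda>x. v x - p x) q = 0)"
  have R: "?R p \<longleftrightarrow> p \<in> P1 \<and> (\<forall>q\<in>P1. (\<Sum>i<length E. (v (vertex E i) - p (vertex E i)) * q (vertex E i)) = 0)" for p
    using area_pos by (simp add: vertex_product_def)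
  obtain p where p: "?R p" using least_squares_exists[of v] R by blast
  have "p' = p" if p': "?R p'" for p'
  proof -
    let ?d = "\<lambda>x. p' x - p x"
    have d: "?d \<in> P1" using p p' P1_diff by blast
    have 1: "(\<Sum>i<length E. (v (vertex E i) - p (vertex E i)) * ?d (vertex E i)) = 0"
      using bspec[OF conjunct2[OF iffD1[OF R p]] d] by simp
    have 2: "(\<Sum>i<length E. (v (vertex E i) - p' (vertex E i)) * ?d (vertex E i)) = 0"
      using bspec[OF conjunct2[OF iffD1[OF R p']] d] by simp
    have "(\<Sum>i<length E. (?d (vertex E i))\<^sup>2)
        = (\<Sum>i<length E. (v (vertex E i) - p (vertex E i)) * ?d (vertex E i))
        - (\<Sum>i<length E. (v (vertex E i) - p' (vertex E i)) * ?d (vertex E i))"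
      unfolding sum_subtractf[symmetric] by (intro sum.cong) (simp_all add: power2_eq_square algebra_simps)
    then have "(\<Sum>i<length E. (?d (vertex E i))\<^sup>2) = 0" by (simp only: 1 2 diff_self)
    then have "\<forall>i\<in>{..<length E}. ?d (vertex E i) = 0"
      by (subst (asm) sum_nonneg_eq_0_iff) auto
    then have "?d = (\<lambda>x. 0)" by (intro P1_zero d) simp
    then show ?thesis by (auto simp: fun_eq_iff)
  qed
  with p have "?R (vertex_projection E v)"
    unfolding vertex_projection_def by (rule theI)
  then show "vertex_projection E v \<in> P1"
    and "q \<in> P1 \<Longrightarrow> (\<Sum>i<length E. (v (vertex E i) - vertex_projection E v (vertex E i)) * q (vertex E i)) = 0"
    unfolding R by blast+
qed

text \<open>Constants belong to the space of the projection, so \<open>p - k\<close> is the orthogonal projection of \<open>v - k\<close>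
  for the vertex product, and its sum of squares over the vertices is not larger (Pythagoras). The
  bound carries over to the element, which lies in the convex hull of its vertices.\<close>

lemma vertex_projection_stable:
  assumes x: "x \<in> region E"
  shows "(vertex_projection E v x - k)\<^sup>2 \<le> (\<Sum>i<length E. (v (vertex E i) - k)\<^sup>2)"
proof -
  let ?x = "vertex E" and ?p = "vertex_projection E v" and ?I = "{..<length E}"
  let ?d = "\<lambda>x. ?p x - k"
  have d: "?d \<in> P1" by (intro P1_diff vertex_projection P1_const)
  have "(\<Sum>i\<in>?I. (v (?x i) - k)\<^sup>2) = (\<Sum>i\<in>?I. (v (?x i) - ?p (?x i))\<^sup>2)
      + 2 * (\<Sum>i\<in>?I. (v (?x i) - ?p (?x i)) * ?d (?x i)) + (\<Sum>i\<in>?I. (?d (?x i))\<^sup>2)"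
    unfolding sum_distrib_left sum.distrib[symmetric]
    by (intro sum.cong) (auto simp: power2_eq_square algebra_simps)
  also have "(\<Sum>i\<in>?I. (v (?x i) - ?p (?x i)) * ?d (?x i)) = 0"
    by (rule vertex_projection(2)[OF d])
  finally have le: "(\<Sum>i\<in>?I. (?d (?x i))\<^sup>2) \<le> (\<Sum>i\<in>?I. (v (?x i) - k)\<^sup>2)"
    by (simp add: sum_nonneg)
  have "\<bar>?d x\<bar> \<le> sqrt (\<Sum>i\<in>?I. (v (?x i) - k)\<^sup>2)"
  proof (rule P1_bound_by_vertices[OF d _ x])
    fix i assume "i < length E"
    then have "(?d (?x i))\<^sup>2 \<le> (\<Sum>i\<in>?I. (?d (?x i))\<^sup>2)" by (intro member_le_sum) auto
    then have "(?d (?x i))\<^sup>2 \<le> (\<Sum>i\<in>?I. (v (?x i) - k)\<^sup>2)" using le by linarith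
    then have "sqrt ((?d (?x i))\<^sup>2) \<le> sqrt (\<Sum>i\<in>?I. (v (?x i) - k)\<^sup>2)" by (rule real_sqrt_le_mono)
    then show "\<bar>?d (?x i)\<bar> \<le> sqrt (\<Sum>i\<in>?I. (v (?x i) - k)\<^sup>2)" by simp
  qed
  then have "\<bar>?d x\<bar>\<^sup>2 \<le> (sqrt (\<Sum>i\<in>?I. (v (?x i) - k)\<^sup>2))\<^sup>2" by (rule power_mono) simp
  then show ?thesis by (simp add: sum_nonneg)
qed

end

section \<open>The error of the projection\<close>

lemma exists_le_average:
  assumes [measurable]: "f \<in> borel_measurable M" "B \<in> sets M"
    and B: "emeasure M B \<noteq> 0" "emeasure M B \<noteq> \<infinity>"
    and le: "(\<integral>\<^sup>+y. indicator B y * f y \<partial>M) \<le> ennreal K * emeasure M B"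
  shows "\<exists>y\<in>B. f y \<le> ennreal K"
proof (rule ccontr)
  assume "\<not> (\<exists>y\<in>B. f y \<le> ennreal K)"
  then have gt: "ennreal K < f y" if "y \<in> B" for y using that by (auto simp: not_le)
  let ?K = "\<lambda>y. indicator B y * ennreal K"
  have int_K: "(\<integral>\<^sup>+y. ?K y \<partial>M) = ennreal K * emeasure M B"
    by (subst mult.commute) (rule nn_integral_cmult_indicator, measurable)
  have "(\<integral>\<^sup>+y. indicator B y * f y - ?K y \<partial>M) = (\<integral>\<^sup>+y. indicator B y * f y \<partial>M) - (\<integral>\<^sup>+y. ?K y \<partial>M)"
  proof (rule nn_integral_diff)
    show "(\<integral>\<^sup>+y. ?K y \<partial>M) \<noteq> \<infinity>" using B by (simp add: int_K ennreal_mult_eq_top_iff)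
    show "AE y in M. ?K y \<le> indicator B y * f y"
      using gt by (intro AE_I2) (auto simp: indicator_def intro: less_imp_le)
  qed measurable
  also have "\<dots> = 0"
    unfolding int_K using B
    by (intro diff_eq_0_ennreal le le_less_trans[OF le]) (simp add: ennreal_mult_less_top less_top)
  finally have "AE y in M. indicator B y * f y - ?K y = 0"
    by (subst (asm) nn_integral_0_iff_AE) auto
  then have "AE y in M. y \<notin> B"
  proof eventually_elim
    case (elim y)
    show "y \<notin> B"
    proof
      assume "y \<in> B"
      with elim gt[of y] show False by (auto simp: diff_eq_0_iff_ennreal dest: leD)
    qed
  qed
  then have "emeasure M B = 0"
    using AE_iff_measurable[of B M "\<lambda>y. y \<notin> B"] sets.sets_into_space[of B M] by (auto simp: Int_absorb1 Collect_conj_eq)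
  with B show False by simp
qed

lemma L2_weak_gradient_cong:
  assumes "\<And>x. x \<in> T \<Longrightarrow> u x = w x"
  shows "L2_weak_gradient T u = L2_weak_gradient T w"
proof -
  have "(LINT x:T|lebesgue. u x * f x) = (LINT x:T|lebesgue. w x * f x)" for f
    unfolding set_lebesgue_integral_def
    by (intro Bochner_Integration.integral_cong) (auto simp: indicator_def assms)
  then show ?thesis by (simp add: L2_weak_gradient_def fun_eq_iff)
qed

text \<open>The integral is \<open>\<alpha>\<^sup>2 + \<alpha> \<beta> + \<beta>\<^sup>2 / 3\<close>, and four times this is \<open>\<alpha>\<^sup>2\<close> plus a square.\<close>

lemma affine_endpoint_le:
  fixes \<alpha> \<beta> :: real
  shows "\<alpha>\<^sup>2 \<le> 4 * integral {0..1} (\<lambda>s. (\<alpha> + s * \<beta>)\<^sup>2)"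
proof -
  have "((\<lambda>s. (\<alpha> + s * \<beta>)\<^sup>2) has_integral
      ((\<alpha>\<^sup>2 * 1 + \<alpha> * \<beta> * 1\<^sup>2 + \<beta>\<^sup>2 * 1 ^ 3 / 3) - (\<alpha>\<^sup>2 * 0 + \<alpha> * \<beta> * 0\<^sup>2 + \<beta>\<^sup>2 * 0 ^ 3 / 3))) {0..1}"
    by (rule fundamental_theorem_of_calculus)
       (auto simp flip: has_real_derivative_iff_has_vector_derivative
          intro!: derivative_eq_intros simp: power2_eq_square algebra_simps)
  then have "integral {0..1} (\<lambda>s. (\<alpha> + s * \<beta>)\<^sup>2) = \<alpha>\<^sup>2 + \<alpha> * \<beta> + \<beta>\<^sup>2 / 3"
    by (simp add: integral_unique)
  moreover have "4 * (\<alpha>\<^sup>2 + \<alpha> * \<beta> + \<beta>\<^sup>2 / 3) = \<alpha>\<^sup>2 + 3 * (\<alpha> + 2 / 3 * \<beta>)\<^sup>2"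
    by (simp add: power2_eq_square algebra_simps)
  ultimately show ?thesis by simp
qed

text \<open>The term \<open>2 \<pi> / \<rho>\<^sup>2\<close> bounds the number of edges, \<open>32 / \<rho>\<close> and \<open>64\<close> come from the estimates on an edge
  and on the element, and the denominator comes from the area of the ball.\<close>

definition estimate_constant :: "real \<Rightarrow> real" where
  "estimate_constant \<rho> = (2 * pi / \<rho>\<^sup>2 * (32 / \<rho>) + 64) / (pi * \<rho>\<^sup>2)"

lemma estimate_constant_pos: "\<rho> > 0 \<Longrightarrow> estimate_constant \<rho> > 0"
  by (simp add: estimate_constant_def add_nonneg_pos)

context star_polygon
begin

definition edge_point :: "nat \<Rightarrow> real \<Rightarrow> real^2" where
  "edge_point i s = vertex E i + s *\<^sub>R (vertex E (Suc i) - vertex E i)"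

text \<open>Arc length on an edge, normalised to total mass one.\<close>

definition edge_measure :: "nat \<Rightarrow> (real^2) measure" where
  "edge_measure i = distr (density lborel (indicator {0..1})) borel (edge_point i)"

lemma edge_point_measurable [measurable]: "edge_point i \<in> borel_measurable borel"
  unfolding edge_point_def by measurable

lemma edge_point_in: "s \<in> {0..1} \<Longrightarrow> edge_point i s \<in> edge E i"
  unfolding edge_def in_segment edge_point_def
  by (intro exI[of _ s]) (simp add: algebra_simps)

lemma sets_edge_measure [measurable_cong]: "sets (edge_measure i) = sets borel"
  by (simp add: edge_measure_def)

lemma nn_integral_edge_measure:
  assumes [measurable]: "f \<in> borel_measurable borel"
  shows "(\<integral>\<^sup>+x. f x \<partial>edge_measure i) = (\<integral>\<^sup>+s. indicator {0..1} s * f (edge_point i s) \<partial>lborel)"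
  by (simp add: edge_measure_def nn_integral_distr nn_integral_density)

lemma emeasure_edge_measure:
  assumes "A \<in> sets borel"
  shows "emeasure (edge_measure i) A = emeasure lborel ({0..1} \<inter> edge_point i -` A)"
proof -
  have [measurable]: "A \<in> sets borel" "edge_point i -` A \<in> sets borel"
    using assms measurable_sets[OF edge_point_measurable assms] by simp_all
  have "emeasure (edge_measure i) A = (\<integral>\<^sup>+x. indicator A x \<partial>edge_measure i)"
    by (rule nn_integral_indicator[symmetric]) (simp add: sets_edge_measure)
  also have "\<dots> = (\<integral>\<^sup>+s. indicator {0..1} s * indicator A (edge_point i s) \<partial>lborel)"
    by (rule nn_integral_edge_measure) simp
  also have "\<dots> = (\<integral>\<^sup>+s. indicator ({0..1} \<inter> edge_point i -` A) s \<partial>lborel)"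
    by (intro nn_integral_cong) (auto simp: indicator_def)
  also have "\<dots> = emeasure lborel ({0..1} \<inter> edge_point i -` A)"
    by (rule nn_integral_indicator) simp
  finally show ?thesis .
qed

lemma rho_le_1: "\<rho> \<le> 1"
proof -
  have 0: "0 < length E" using length_ge_3 by linarith
  have "\<rho> * h \<le> dist (vertex E 0) (vertex E (Suc 0))" by (rule edge_length[OF 0])
  also have "\<dots> \<le> h" by (intro dist_le_h edge_closure[OF 0]) (auto simp: edge_def)
  finally show ?thesis using h_pos by simp
qed

text \<open>A ball of radius \<open>R\<close> meets the edge in parameters within \<open>R / norm d\<close> of the parameter \<open>s0\<close> of the
  projection of the centre onto the line, where \<open>norm d\<close> is the length of the edge.\<close>

lemma edge_measure_growth:
  assumes i: "i < length E" and R: "R > 0"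
  shows "emeasure (edge_measure i) (cball p R) \<le> ennreal (2 / (\<rho> * h) * R)"
proof -
  define a d where "a = vertex E i" and "d = vertex E (Suc i) - vertex E i"
  have len: "\<rho> * h \<le> norm d" using edge_length[OF i] by (simp add: d_def dist_norm norm_minus_commute)
  have pos: "0 < \<rho> * h" using rho_pos h_pos by simp
  define s0 where "s0 = ((p - a) \<bullet> d) / (norm d)\<^sup>2"
  define \<tau> where "\<tau> = R / (\<rho> * h)"
  have "{0..1} \<inter> edge_point i -` cball p R \<subseteq> {s0 - \<tau> .. s0 + \<tau>}"
  proof
    fix s assume "s \<in> {0..1} \<inter> edge_point i -` cball p R"
    then have s: "norm (a + s *\<^sub>R d - p) \<le> R"
      by (simp add: edge_point_def a_def d_def dist_norm norm_minus_commute)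
    have "(a + s *\<^sub>R d - p) \<bullet> d = (s - s0) * (norm d)\<^sup>2"
    proof -
      have "s0 * (norm d)\<^sup>2 = (p - a) \<bullet> d" using len pos by (simp add: s0_def)
      then show ?thesis
        by (simp add: inner_diff_left inner_add_left left_diff_distrib power2_norm_eq_inner)
    qed
    then have "\<bar>s - s0\<bar> * (norm d)\<^sup>2 = \<bar>(a + s *\<^sub>R d - p) \<bullet> d\<bar>" by (simp add: abs_mult)
    also have "\<dots> \<le> norm (a + s *\<^sub>R d - p) * norm d" by (rule Cauchy_Schwarz_ineq2)
    also have "\<dots> \<le> R * norm d" using s by (rule mult_right_mono) simp
    finally have "(\<bar>s - s0\<bar> * norm d) * norm d \<le> R * norm d" by (simp add: power2_eq_square mult.assoc)
    then have "\<bar>s - s0\<bar> * norm d \<le> R" by (rule mult_right_le_imp_le) (use len pos in linarith)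
    moreover have "\<bar>s - s0\<bar> * (\<rho> * h) \<le> \<bar>s - s0\<bar> * norm d" using len by (intro mult_left_mono) auto
    ultimately have "\<bar>s - s0\<bar> * (\<rho> * h) \<le> R" by linarith
    then have "\<bar>s - s0\<bar> \<le> \<tau>" using pos by (simp add: \<tau>_def pos_le_divide_eq)
    then show "s \<in> {s0 - \<tau> .. s0 + \<tau>}" by auto
  qed
  then have "emeasure (edge_measure i) (cball p R) \<le> emeasure lborel {s0 - \<tau> .. s0 + \<tau>}"
    by (subst emeasure_edge_measure) (auto intro!: emeasure_mono)
  also have "\<dots> = ennreal (2 / (\<rho> * h) * R)"
    using R pos by (simp add: \<tau>_def)
  finally show ?thesis .
qed

lemma edge_measure_total: "emeasure (edge_measure i) UNIV = 1"
  by (simp add: emeasure_edge_measure)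

lemma edge_difference_estimate:
  assumes cont: "continuous_on UNIV V" and weak: "L2_weak_gradient S V g" and i: "i < length E"
  shows "(\<integral>\<^sup>+y. indicator (ball c r) y * (\<integral>\<^sup>+s. indicator {0..1} s * ennreal ((V (edge_point i s) - V y)\<^sup>2) \<partial>lborel) \<partial>lborel)
     \<le> ennreal (32 / \<rho> * h\<^sup>2) * energy g"
proof -
  have [measurable]: "V \<in> borel_measurable borel" using cont by (rule borel_measurable_continuous_onI)
  interpret e: finite_measure "edge_measure i"
    by (rule finite_measureI) (simp add: edge_measure_total sets_eq_imp_space_eq[OF sets_edge_measure])
  interpret pair_sigma_finite "edge_measure i" lborel ..
  define B where "B = ball c r"
  have [measurable]: "B \<in> sets borel" by (simp add: B_def)
  have "(\<integral>\<^sup>+y. indicator B y * (\<integral>\<^sup>+s. indicator {0..1} s * ennreal ((V (edge_point i s) - V y)\<^sup>2) \<partial>lborel) \<partial>lborel)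
     = (\<integral>\<^sup>+y. \<integral>\<^sup>+x. indicator B y * ennreal ((V x - V y)\<^sup>2) \<partial>edge_measure i \<partial>lborel)"
    by (intro nn_integral_cong, subst nn_integral_cmult, measurable)
       (simp add: nn_integral_edge_measure)
  also have "\<dots> = (\<integral>\<^sup>+x. \<integral>\<^sup>+y. indicator B y * ennreal ((V x - V y)\<^sup>2) \<partial>lborel \<partial>edge_measure i)"
    by (rule Fubini') measurable
  also have "\<dots> \<le> ennreal (16 * (2 / (\<rho> * h)) * h ^ 3) * energy g"
    unfolding B_def
  proof (rule averaged_difference_estimate[OF cont weak sets_edge_measure])
    show "sigma_finite_measure (edge_measure i)" ..
    have "AE s in density lborel (indicator {0..1}). edge_point i s \<in> closure S"
      by (subst AE_density) (auto intro!: AE_I2 edge_closure[OF i] edge_point_in simp: indicator_def)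
    then show "AE x in edge_measure i. x \<in> closure S"
      unfolding edge_measure_def by (subst AE_distr_iff) auto
    show "emeasure (edge_measure i) (cball p R) \<le> ennreal (2 / (\<rho> * h) * R)" if "R > 0" for p R
      by (rule edge_measure_growth[OF i that])
    show "emeasure (edge_measure i) UNIV \<le> ennreal (2 / (\<rho> * h) * h)"
    proof -
      have "1 \<le> 2 / (\<rho> * h) * h" using rho_le_1 rho_pos h_pos by (simp add: field_simps)
      then have "ennreal 1 \<le> ennreal (2 / (\<rho> * h) * h)" by (rule ennreal_leI)
      then show ?thesis by (simp add: edge_measure_total)
    qed
    show "0 \<le> 2 / (\<rho> * h)" using rho_pos h_nonneg by simp
  qed
  also have "16 * (2 / (\<rho> * h)) * h ^ 3 = 32 / \<rho> * h\<^sup>2"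
    using h_pos by (simp add: power3_eq_cube power2_eq_square)
  finally show ?thesis by (simp add: B_def)
qed

text \<open>Area on the element grows linearly, with factor \<open>4 h\<close>: small balls have area \<open>\<pi> R\<^sup>2 \<le> 4 h R\<close>, and for
  larger ones the area of the element is at most \<open>\<pi> h\<^sup>2\<close>.\<close>

lemma area_difference_estimate:
  assumes cont: "continuous_on UNIV V" and weak: "L2_weak_gradient S V g"
  shows "(\<integral>\<^sup>+y. indicator (ball c r) y * (\<integral>\<^sup>+x. indicator S x * ennreal ((V x - V y)\<^sup>2) \<partial>lborel) \<partial>lborel)
     \<le> ennreal (64 * h ^ 4) * energy g"
proof -
  have [measurable]: "V \<in> borel_measurable borel" using cont by (rule borel_measurable_continuous_onI)
  have [measurable]: "S \<in> sets borel" using open_region by simp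
  define \<mu> where "\<mu> = density lborel (indicator S)"
  have sets: "sets \<mu> = sets borel" by (simp add: \<mu>_def)
  note [measurable_cong] = sets
  have em: "emeasure \<mu> A = emeasure lborel (S \<inter> A)" if [measurable]: "A \<in> sets borel" for A
  proof -
    have "emeasure \<mu> A = (\<integral>\<^sup>+x. indicator S x * indicator A x \<partial>lborel)"
      unfolding \<mu>_def by (rule emeasure_density) simp_all
    also have "\<dots> = (\<integral>\<^sup>+x. indicator (S \<inter> A) x \<partial>lborel)"
      by (intro nn_integral_cong) (auto simp: indicator_def)
    also have "\<dots> = emeasure lborel (S \<inter> A)" by (rule nn_integral_indicator) simp
    finally show ?thesis .
  qed
  have ball: "emeasure lborel (cball p R) = ennreal (pi * R\<^sup>2)" if "R \<ge> 0" for p :: "real^2" and R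
    using that by (simp add: emeasure_cball unit_ball_vol_2)
  have S_le: "emeasure \<mu> A \<le> ennreal (pi * h\<^sup>2)" if "A \<in> sets borel" for A
    using region_subset_cball h_nonneg that
    by (auto simp: em simp flip: ball[of h c] intro!: emeasure_mono)
  have growth: "emeasure \<mu> (cball p R) \<le> ennreal (4 * h * R)" if R: "R > 0" for p R
  proof (cases "R \<le> h")
    case True
    have "emeasure \<mu> (cball p R) \<le> ennreal (pi * R\<^sup>2)"
      using R by (auto simp: em simp flip: ball[of R p] intro!: emeasure_mono)
    also have "pi * R\<^sup>2 \<le> 4 * (h * R)"
      using True R pi_less_4 by (intro mult_mono) (auto simp: power2_eq_square)
    finally show ?thesis by (simp add: ennreal_leI mult.assoc)
  next
    case False
    have "emeasure \<mu> (cball p R) \<le> ennreal (pi * h\<^sup>2)" by (rule S_le) simp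
    also have "pi * h\<^sup>2 \<le> 4 * (h * R)"
      using False h_nonneg pi_less_4 by (intro mult_mono) (auto simp: power2_eq_square mult_left_mono)
    finally show ?thesis by (simp add: ennreal_leI mult.assoc)
  qed
  have total: "emeasure \<mu> UNIV \<le> ennreal (4 * h * h)"
  proof -
    have "emeasure \<mu> UNIV \<le> ennreal (pi * h\<^sup>2)" by (rule S_le) simp
    also have "pi * h\<^sup>2 \<le> 4 * h\<^sup>2" using pi_less_4 by (intro mult_right_mono) auto
    finally show ?thesis by (simp add: ennreal_leI mult.assoc power2_eq_square)
  qed
  interpret e: finite_measure \<mu>
    using total by (intro finite_measureI) (auto simp: sets_eq_imp_space_eq[OF sets] top_unique)
  interpret pair_sigma_finite \<mu> lborel ..
  define B where "B = ball c r"
  have [measurable]: "B \<in> sets borel" by (simp add: B_def)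
  have "(\<integral>\<^sup>+y. indicator B y * (\<integral>\<^sup>+x. indicator S x * ennreal ((V x - V y)\<^sup>2) \<partial>lborel) \<partial>lborel)
     = (\<integral>\<^sup>+y. \<integral>\<^sup>+x. indicator B y * ennreal ((V x - V y)\<^sup>2) \<partial>\<mu> \<partial>lborel)"
    by (intro nn_integral_cong, subst nn_integral_cmult, measurable)
       (simp add: \<mu>_def nn_integral_density)
  also have "\<dots> = (\<integral>\<^sup>+x. \<integral>\<^sup>+y. indicator B y * ennreal ((V x - V y)\<^sup>2) \<partial>lborel \<partial>\<mu>)"
    by (rule Fubini') measurable
  also have "\<dots> \<le> ennreal (16 * (4 * h) * h ^ 3) * energy g"
    unfolding B_def
  proof (rule averaged_difference_estimate[OF cont weak sets _ _ growth total])
    show "sigma_finite_measure \<mu>" ..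
    show "AE x in \<mu>. x \<in> closure S"
      unfolding \<mu>_def using closure_subset by (subst AE_density) (auto intro!: AE_I2 simp: indicator_def)
    show "0 \<le> 4 * h" using h_nonneg by simp
  qed
  also have "16 * (4 * h) * h ^ 3 = 64 * h ^ 4" by (simp add: power3_eq_cube power4_eq_xxxx)
  finally show ?thesis by (simp add: B_def)
qed

abbreviation "K\<^sub>\<rho> \<equiv> estimate_constant \<rho>"

lemmas estimate_constant_positive = estimate_constant_pos[OF rho_pos]

text \<open>Add the estimates for all edges and, with weight \<open>1 / h\<^sup>2\<close>, the one for the element. The mean over the
  ball of this sum, as a function of \<open>y\<close>, is bounded, so some \<open>y\<close> satisfies the bound for all terms at
  once; take \<open>k = V y\<close>.\<close>

lemma good_reference_value:
  assumes cont: "continuous_on UNIV V" and weak: "L2_weak_gradient S V g"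
    and D: "energy g = ennreal D" "D \<ge> 0"
  shows "\<exists>k. (\<Sum>i<length E. integral {0..1} (\<lambda>s. (V (edge_point i s) - k)\<^sup>2)) \<le> K\<^sub>\<rho> * D \<and>
      (\<integral>\<^sup>+x. indicator S x * ennreal ((V x - k)\<^sup>2) \<partial>lborel) \<le> ennreal (K\<^sub>\<rho> * h\<^sup>2 * D)"
proof -
  have [measurable]: "V \<in> borel_measurable borel" using cont by (rule borel_measurable_continuous_onI)
  have [measurable]: "S \<in> sets borel" using open_region by simp
  define B where "B = ball c r"
  have B [measurable]: "B \<in> sets borel" by (simp add: B_def)
  have emB: "emeasure lborel B = ennreal (pi * r\<^sup>2)"
    using r_pos by (simp add: B_def emeasure_ball unit_ball_vol_2)
  define \<Phi> where "\<Phi> i y = (\<integral>\<^sup>+s. indicator {0..1} s * ennreal ((V (edge_point i s) - V y)\<^sup>2) \<partial>lborel)" for i y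
  define \<Psi> where "\<Psi> y = (\<integral>\<^sup>+x. indicator S x * ennreal ((V x - V y)\<^sup>2) \<partial>lborel)" for y
  have meas [measurable]: "\<Phi> i \<in> borel_measurable borel" "\<Psi> \<in> borel_measurable borel" for i
    unfolding \<Phi>_def \<Psi>_def by measurable
  let ?f = "\<lambda>y. (\<Sum>i<length E. \<Phi> i y) + ennreal (1 / h\<^sup>2) * \<Psi> y"
  let ?C = "2 * pi / \<rho>\<^sup>2 * (32 / \<rho>) + 64"
  have "(\<integral>\<^sup>+y. indicator B y * ?f y \<partial>lborel)
     = (\<integral>\<^sup>+y. (\<Sum>i<length E. indicator B y * \<Phi> i y) + ennreal (1 / h\<^sup>2) * (indicator B y * \<Psi> y) \<partial>lborel)"
    by (intro nn_integral_cong) (simp add: distrib_left sum_distrib_left mult.left_commute)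
  also have "\<dots> = (\<Sum>i<length E. \<integral>\<^sup>+y. indicator B y * \<Phi> i y \<partial>lborel)
      + ennreal (1 / h\<^sup>2) * (\<integral>\<^sup>+y. indicator B y * \<Psi> y \<partial>lborel)"
    by (subst nn_integral_add, measurable, subst nn_integral_sum, measurable, subst nn_integral_cmult, measurable)
  also have "\<dots> \<le> (\<Sum>i<length E. ennreal (32 / \<rho> * h\<^sup>2) * energy g)
      + ennreal (1 / h\<^sup>2) * (ennreal (64 * h ^ 4) * energy g)"
    using edge_difference_estimate[OF cont weak] area_difference_estimate[OF cont weak]
    unfolding \<Phi>_def \<Psi>_def B_def by (intro add_mono sum_mono mult_left_mono) auto
  also have "\<dots> = ennreal (length E * (32 / \<rho> * h\<^sup>2 * D) + 1 / h\<^sup>2 * (64 * h ^ 4 * D))"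
    using D rho_pos
    by (simp add: ennreal_plus ennreal_of_nat_eq_real_of_nat flip: ennreal_mult)
  also have "\<dots> \<le> ennreal (K\<^sub>\<rho> * D * (pi * r\<^sup>2))"
  proof (rule ennreal_leI)
    have "length E * (32 / \<rho> * h\<^sup>2 * D) + 1 / h\<^sup>2 * (64 * h ^ 4 * D) = (length E * (32 / \<rho>) + 64) * (h\<^sup>2 * D)"
      using h_pos by (simp add: power2_eq_square power4_eq_xxxx distrib_right)
    also have "\<dots> \<le> ?C * (h\<^sup>2 * D)"
      using number_of_edges D rho_pos by (intro mult_right_mono add_mono) auto
    also have "\<dots> = K\<^sub>\<rho> * D * (pi * (\<rho> * h)\<^sup>2)"
      using rho_pos by (simp add: estimate_constant_def power_mult_distrib)
    also have "\<dots> \<le> K\<^sub>\<rho> * D * (pi * r\<^sup>2)"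
      using r_gt rho_pos h_nonneg estimate_constant_positive D by (intro mult_left_mono power_mono) auto
    finally show "length E * (32 / \<rho> * h\<^sup>2 * D) + 1 / h\<^sup>2 * (64 * h ^ 4 * D) \<le> K\<^sub>\<rho> * D * (pi * r\<^sup>2)" .
  qed
  also have "\<dots> = ennreal (K\<^sub>\<rho> * D) * emeasure lborel B"
    using estimate_constant_positive D by (simp add: emB ennreal_mult)
  finally have "\<exists>y\<in>B. ?f y \<le> ennreal (K\<^sub>\<rho> * D)"
    using r_pos by (intro exists_le_average[of _ lborel]) (simp_all add: emB ennreal_eq_0_iff not_le)
  then obtain y where y: "?f y \<le> ennreal (K\<^sub>\<rho> * D)" by blast
  have K: "K\<^sub>\<rho> * D \<ge> 0" using estimate_constant_positive D by simp
  have edge: "\<Phi> i y = ennreal (integral {0..1} (\<lambda>s. (V (edge_point i s) - V y)\<^sup>2))"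
    and edge_nonneg: "integral {0..1} (\<lambda>s. (V (edge_point i s) - V y)\<^sup>2) \<ge> 0" for i
  proof -
    have int: "(\<lambda>s. (V (edge_point i s) - V y)\<^sup>2) integrable_on {0..1}"
      unfolding edge_point_def
      by (intro integrable_continuous_real continuous_intros continuous_on_compose2[OF cont]) auto
    then show "integral {0..1} (\<lambda>s. (V (edge_point i s) - V y)\<^sup>2) \<ge> 0"
      by (rule Henstock_Kurzweil_Integration.integral_nonneg) simp
    show "\<Phi> i y = ennreal (integral {0..1} (\<lambda>s. (V (edge_point i s) - V y)\<^sup>2))"
      unfolding \<Phi>_def
      by (subst mult.commute, rule nn_integral_has_integral_lebesgue') (use int in auto)
  qed
  have "(\<Sum>i<length E. \<Phi> i y) \<le> ennreal (K\<^sub>\<rho> * D)"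
    using y by (rule order.trans[rotated]) simp
  then have 1: "(\<Sum>i<length E. integral {0..1} (\<lambda>s. (V (edge_point i s) - V y)\<^sup>2)) \<le> K\<^sub>\<rho> * D"
    using edge_nonneg K by (simp add: edge sum_ennreal sum_nonneg)
  have "ennreal (1 / h\<^sup>2) * \<Psi> y \<le> ennreal (K\<^sub>\<rho> * D)"
    using y by (rule order.trans[rotated]) simp
  then have "ennreal (h\<^sup>2) * (ennreal (1 / h\<^sup>2) * \<Psi> y) \<le> ennreal (h\<^sup>2) * ennreal (K\<^sub>\<rho> * D)"
    by (rule mult_left_mono) simp
  also have "ennreal (h\<^sup>2) * (ennreal (1 / h\<^sup>2) * \<Psi> y) = \<Psi> y"
    using h_pos by (simp add: mult.assoc[symmetric] flip: ennreal_mult)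
  also have "ennreal (h\<^sup>2) * ennreal (K\<^sub>\<rho> * D) = ennreal (K\<^sub>\<rho> * h\<^sup>2 * D)"
    using K by (simp add: mult_ac flip: ennreal_mult)
  finally show ?thesis using 1 unfolding \<Psi>_def by blast
qed

text \<open>Split \<open>v - p\<close> into \<open>v - k\<close> and \<open>k - p\<close>. In units of \<open>K\<^sub>\<rho> h\<^sup>2\<close> times the
  squared seminorm, the first part contributes \<open>2\<close>, and the second one \<open>2 * 4 * 4\<close>: the factors come from the splitting, from the passage to vertex values, and
  from the area bound \<open>4 h\<^sup>2\<close>.\<close>

lemma projection_error:
  assumes v: "v \<in> Vh_local E"
  shows "L2_norm S (\<lambda>x. v x - vertex_projection E v x) \<le> sqrt (34 * K\<^sub>\<rho>) * h * H1_seminorm S v"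
proof -
  let ?p = "vertex_projection E v" and ?g = "weak_gradient S v"
  have "v \<in> H1 S" and cont_v: "continuous_on (closure S) v"
    and affine: "\<And>e. e \<in> edges E \<Longrightarrow> \<exists>p\<in>P1. \<forall>x\<in>e. v x = p x"
    using v by (auto simp: Vh_local_def)
  then have "\<exists>g. L2_weak_gradient S v g" by (simp add: H1_def)
  then have weak_v: "L2_weak_gradient S v ?g" unfolding weak_gradient_def by (rule someI_ex)
  obtain V where cont: "continuous_on UNIV V" and V: "\<And>x. x \<in> closure S \<Longrightarrow> V x = v x"
    using Tietze_unbounded[OF cont_v, of UNIV] by auto
  have V_S: "V x = v x" if "x \<in> S" for x using V closure_subset that by blast
  then have weak: "L2_weak_gradient S V ?g" using weak_v L2_weak_gradient_cong[of S V v] by simp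
  define D where "D = (LINT y|lebesgue. indicator S y * (norm (?g y))\<^sup>2)"
  have int_g: "integrable lebesgue (\<lambda>y. indicator S y * (norm (?g y))\<^sup>2)"
    using weak by (simp add: L2_weak_gradient_def L2_def set_integrable_def)
  have D: "energy ?g = ennreal D" "D \<ge> 0"
    unfolding energy_def D_def by (simp_all add: nn_integral_eq_integral[OF int_g])
  have seminorm: "H1_seminorm S v = sqrt D"
    by (simp add: H1_seminorm_def L2_norm_def set_lebesgue_integral_def D_def)
    obtain k where edge: "(\<Sum>i<length E. integral {0..1} (\<lambda>s. (V (edge_point i s) - k)\<^sup>2)) \<le> K\<^sub>\<rho> * D"
    and area: "(\<integral>\<^sup>+x. indicator S x * ennreal ((V x - k)\<^sup>2) \<partial>lborel) \<le> ennreal (K\<^sub>\<rho> * h\<^sup>2 * D)"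
    using good_reference_value[OF cont weak D] by blast
  have "(v (vertex E i) - k)\<^sup>2 \<le> 4 * integral {0..1} (\<lambda>s. (V (edge_point i s) - k)\<^sup>2)" if i: "i < length E" for i
  proof -
    obtain \<alpha> \<beta> where ab: "\<forall>x\<in>edge E i. v x = \<alpha> + \<beta> \<bullet> x"
      using affine[of "edge E i"] i by (auto simp: edges_def P1_def)
    let ?\<alpha> = "\<alpha> + \<beta> \<bullet> vertex E i - k" and ?\<beta> = "\<beta> \<bullet> (vertex E (Suc i) - vertex E i)"
    have "V (edge_point i s) - k = ?\<alpha> + s * ?\<beta>" if "s \<in> {0..1}" for s
      using V[OF edge_closure[OF i edge_point_in[OF that]]] ab edge_point_in[OF that, of i]
      by (simp add: edge_point_def inner_add_right)
    then have "integral {0..1} (\<lambda>s. (V (edge_point i s) - k)\<^sup>2) = integral {0..1} (\<lambda>s. (?\<alpha> + s * ?\<beta>)\<^sup>2)"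
      by (intro Henstock_Kurzweil_Integration.integral_cong) (simp only:)
    moreover have "v (vertex E i) - k = ?\<alpha>" using ab by (simp add: edge_def)
    ultimately show ?thesis using affine_endpoint_le[of ?\<alpha> ?\<beta>] by simp
  qed
  then have "(\<Sum>i<length E. (v (vertex E i) - k)\<^sup>2)
      \<le> (\<Sum>i<length E. 4 * integral {0..1} (\<lambda>s. (V (edge_point i s) - k)\<^sup>2))"
    by (intro sum_mono) simp
  also have "\<dots> \<le> 4 * (K\<^sub>\<rho> * D)" using edge by (simp flip: sum_distrib_left)
  finally have proj: "(?p x - k)\<^sup>2 \<le> 4 * (K\<^sub>\<rho> * D)" if "x \<in> S" for x
    using vertex_projection_stable[OF that, of v k] by linarith
  have [measurable]: "V \<in> borel_measurable borel" using cont by (rule borel_measurable_continuous_onI)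
  have [measurable]: "S \<in> sets borel" using open_region by simp
  have "continuous_on UNIV ?p"
    using vertex_projection(1)[of v] by (auto simp: P1_def intro!: continuous_intros)
  then have [measurable]: "?p \<in> borel_measurable borel" by (rule borel_measurable_continuous_onI)
  have K: "K\<^sub>\<rho> * D \<ge> 0" using estimate_constant_positive D by simp
  have "(\<integral>\<^sup>+x. ennreal (indicator S x * (V x - ?p x)\<^sup>2) \<partial>lborel)
     \<le> (\<integral>\<^sup>+x. 2 * (indicator S x * ennreal ((V x - k)\<^sup>2)) + ennreal (8 * (K\<^sub>\<rho> * D)) * indicator S x \<partial>lborel)"
  proof (rule nn_integral_mono)
    fix x
    show "ennreal (indicator S x * (V x - ?p x)\<^sup>2)
       \<le> 2 * (indicator S x * ennreal ((V x - k)\<^sup>2)) + ennreal (8 * (K\<^sub>\<rho> * D)) * indicator S x"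
    proof (cases "x \<in> S")
      case True
      define \<alpha> \<beta> where "\<alpha> = V x - k" and "\<beta> = k - ?p x"
      have "(\<alpha> + \<beta>)\<^sup>2 + (\<alpha> - \<beta>)\<^sup>2 = 2 * \<alpha>\<^sup>2 + 2 * \<beta>\<^sup>2"
        by (simp add: power2_eq_square algebra_simps)
      moreover have "\<beta>\<^sup>2 \<le> 4 * (K\<^sub>\<rho> * D)" using proj[OF True] by (simp add: \<beta>_def power2_commute)
      ultimately have "(\<alpha> + \<beta>)\<^sup>2 \<le> 2 * \<alpha>\<^sup>2 + 8 * (K\<^sub>\<rho> * D)"
        using zero_le_power2[of "\<alpha> - \<beta>"] by linarith
      then have "(V x - ?p x)\<^sup>2 \<le> 2 * (V x - k)\<^sup>2 + 8 * (K\<^sub>\<rho> * D)" by (simp add: \<alpha>_def \<beta>_def)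
      then have "ennreal ((V x - ?p x)\<^sup>2) \<le> ennreal (2 * (V x - k)\<^sup>2 + 8 * (K\<^sub>\<rho> * D))" by (rule ennreal_leI)
      also have "\<dots> = 2 * ennreal ((V x - k)\<^sup>2) + ennreal (8 * (K\<^sub>\<rho> * D))"
        using K by (simp add: ennreal_plus ennreal_mult del: ennreal_plus[symmetric])
      finally show ?thesis using True by simp
    qed simp
  qed
  also have "\<dots> = (\<integral>\<^sup>+x. 2 * (indicator S x * ennreal ((V x - k)\<^sup>2)) \<partial>lborel)
      + (\<integral>\<^sup>+x. ennreal (8 * (K\<^sub>\<rho> * D)) * indicator S x \<partial>lborel)"
    by (rule nn_integral_add) measurable
  also have "(\<integral>\<^sup>+x. 2 * (indicator S x * ennreal ((V x - k)\<^sup>2)) \<partial>lborel)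
      = 2 * (\<integral>\<^sup>+x. indicator S x * ennreal ((V x - k)\<^sup>2) \<partial>lborel)"
    by (rule nn_integral_cmult) measurable
  also have "(\<integral>\<^sup>+x. ennreal (8 * (K\<^sub>\<rho> * D)) * indicator S x \<partial>lborel) = ennreal (8 * (K\<^sub>\<rho> * D)) * emeasure lborel S"
    by (rule nn_integral_cmult_indicator) simp
  also have "2 * (\<integral>\<^sup>+x. indicator S x * ennreal ((V x - k)\<^sup>2) \<partial>lborel) + ennreal (8 * (K\<^sub>\<rho> * D)) * emeasure lborel S
     \<le> 2 * ennreal (K\<^sub>\<rho> * h\<^sup>2 * D) + ennreal (8 * (K\<^sub>\<rho> * D)) * ennreal (4 * h\<^sup>2)"
  proof (intro add_mono mult_left_mono area)
    have "emeasure lborel S \<le> emeasure lborel (cball c h)"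
      by (rule emeasure_mono[OF region_subset_cball]) simp
    also have "\<dots> = ennreal (pi * h\<^sup>2)" using h_nonneg by (simp add: emeasure_cball unit_ball_vol_2)
    also have "\<dots> \<le> ennreal (4 * h\<^sup>2)" using pi_less_4 by (intro ennreal_leI mult_right_mono) auto
    finally show "emeasure lborel S \<le> ennreal (4 * h\<^sup>2)" .
  qed auto
  also have "\<dots> = ennreal (2 * (K\<^sub>\<rho> * h\<^sup>2 * D) + 8 * (K\<^sub>\<rho> * D) * (4 * h\<^sup>2))"
  proof -
    have nonneg: "0 \<le> K\<^sub>\<rho> * h\<^sup>2 * D" using estimate_constant_positive D by simp
    have "2 * ennreal (K\<^sub>\<rho> * h\<^sup>2 * D) = ennreal (2 * (K\<^sub>\<rho> * h\<^sup>2 * D))"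
      using ennreal_mult[OF _ nonneg, of 2] by simp
    moreover have "ennreal (8 * (K\<^sub>\<rho> * D)) * ennreal (4 * h\<^sup>2) = ennreal (8 * (K\<^sub>\<rho> * D) * (4 * h\<^sup>2))"
      using K by (intro ennreal_mult[symmetric]) auto
    moreover have "ennreal (2 * (K\<^sub>\<rho> * h\<^sup>2 * D) + 8 * (K\<^sub>\<rho> * D) * (4 * h\<^sup>2))
        = ennreal (2 * (K\<^sub>\<rho> * h\<^sup>2 * D)) + ennreal (8 * (K\<^sub>\<rho> * D) * (4 * h\<^sup>2))"
      by (intro ennreal_plus mult_nonneg_nonneg nonneg K) simp_all
    ultimately show ?thesis by (simp only:)
  qed
  also have "2 * (K\<^sub>\<rho> * h\<^sup>2 * D) + 8 * (K\<^sub>\<rho> * D) * (4 * h\<^sup>2) = 34 * K\<^sub>\<rho> * h\<^sup>2 * D" by simp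
  finally have bound: "(\<integral>\<^sup>+x. ennreal (indicator S x * (V x - ?p x)\<^sup>2) \<partial>lebesgue) \<le> ennreal (34 * K\<^sub>\<rho> * h\<^sup>2 * D)"
    by (simp only: nn_integral_completion)
  have "(LINT x:S|lebesgue. (norm (v x - ?p x))\<^sup>2) = (LINT x|lebesgue. indicator S x * (V x - ?p x)\<^sup>2)"
    unfolding set_lebesgue_integral_def using V_S
    by (intro Bochner_Integration.integral_cong) (auto simp: indicator_def)
  also have "\<dots> = enn2real (\<integral>\<^sup>+x. ennreal (indicator S x * (V x - ?p x)\<^sup>2) \<partial>lebesgue)"
    by (rule integral_eq_nn_integral) (auto intro!: measurable_completion)
  also have "\<dots> \<le> 34 * K\<^sub>\<rho> * h\<^sup>2 * D"
    using bound estimate_constant_positive D by (intro enn2real_leI) auto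
  finally have "L2_norm S (\<lambda>x. v x - ?p x) \<le> sqrt (34 * K\<^sub>\<rho> * h\<^sup>2 * D)"
    unfolding L2_norm_def by (rule real_sqrt_le_mono)
  also have "\<dots> = sqrt (34 * K\<^sub>\<rho>) * h * H1_seminorm S v"
    using h_nonneg by (simp add: seminorm real_sqrt_mult)
  finally show ?thesis .
qed

end

theorem lemma3p8:
  fixes \<rho> :: real
  assumes "\<rho> > 0"
  shows "\<exists>C>0. \<forall>\<Omega> \<T>. polygonal_domain \<Omega> \<and> polygonal_mesh \<Omega> \<T> \<and> mesh_M1 \<rho> \<T> \<and> mesh_M2 \<rho> \<T> \<longrightarrow>
     (\<forall>E\<in>\<T>. \<forall>v\<in>Vh \<Omega> \<T>.
        L2_norm (region E) (\<lambda>x. v x - vertex_projection E v x)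
          \<le> C * diameter (region E) * H1_seminorm (region E) v)"
proof -
  let ?K = "estimate_constant \<rho>"
  have "?K > 0" using assms by (rule estimate_constant_pos)
  moreover have "L2_norm (region E) (\<lambda>x. v x - vertex_projection E v x)
      \<le> sqrt (34 * ?K) * diameter (region E) * H1_seminorm (region E) v"
    if mesh: "polygonal_mesh \<Omega> \<T>" "mesh_M1 \<rho> \<T>" "mesh_M2 \<rho> \<T>" and E: "E \<in> \<T>" and v: "v \<in> Vh \<Omega> \<T>"
    for \<Omega> \<T> E v
  proof -
    obtain c r where "r > \<rho> * diameter (region E)" "ball c r \<subseteq> region E"
      "\<And>x y. y \<in> ball c r \<Longrightarrow> x \<in> region E \<Longrightarrow> closed_segment y x \<subseteq> region E"
      using mesh(2) E unfolding mesh_M1_def by blast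
    then interpret star_polygon E c r \<rho> "diameter (region E)"
      using mesh E assms by unfold_locales (auto simp: polygonal_mesh_def mesh_M2_def)
    show ?thesis
      using projection_error[of v] v E unfolding Vh_def by blast
  qed
  ultimately show ?thesis by (intro exI[of _ "sqrt (34 * ?K)"]) auto
qed

end
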